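(* For every $\rho\in\mathcal P^-$ it holds $$\overline C(\rho)=\widetilde C(\tilde\rho)\qquad\text{for}\quad \tilde\rho:=S^\#\rho+(1-\|\rho\|)\delta_\omega .$$
   Context: Let $d\ge1$ and $N\ge 2$ be integers. $\mathcal P$ is the set of Borel probability measures on $\mathbb R^d$; $\mathcal P^-$ is the set of nonnegative Borel measures $\rho$ on $\mathbb R^d$ with total mass $\|\rho\|=\rho(\mathbb R^d)\le 1$. $\rho_n\stackrel{*}{\rightharpoonup}\rho$ denotes weak* convergence in duality with the continuous functions on $\mathbb R^d$ vanishing at infinity. Let $c(x_1,\dots,x_N)=\sum_{1\le i<j\le N}\frac1{|x_i-x_j|}$ for $x_i\in\mathbb R^d$ (with $1/0=+\infty$). For $\rho\in\mathcal P$, $C(\rho)=\inf\{\int c\,dP : P \text{ Borel probability on }(\mathbb R^d)^N \text{ with all } N \text{ marginals equal to } \rho\}$. For $\rho\in\mathcal P^-$, $\overline C(\rho)=\inf\{\liminf_n C(\rho_n) : \rho_n\in\mathcal P,\ \rho_n\stackrel{*}{\rightharpoonup}\rho\}$. $X=\mathbb R^d\cup\{\omega\}$ is the Alexandroff (one-point) compactification of $\mathbb R^d$, $S:\mathbb R^d\to X$ the inclusion, $S^\#\rho$ the push-forward of $\rho$. On $X^N$ let $\tilde c(x_1,\dots,x_N)=\sum_{1\le i<j\le N}\frac1{|x_i-x_j|}$, with the convention $1/|a-b|=0$ whenever $a$ or $b$ equals $\omega$. For a Borel probability $\tilde\rho$ on $X$, $\widetilde C(\tilde\rho)=\min\{\int_{X^N}\tilde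 c\,d\widetilde P : \widetilde P\text{ Borel probability on }X^N\text{ with all } N\text{ marginals equal to }\tilde\rho\}$. *)

theory Defs
  imports "HOL-Analysis.Analysis" "HOL-Probability.Probability"
begin

definition borel_alg :: "'x topology \<Rightarrow> 'x measure" where
  "borel_alg T = sigma (topspace T) {U. openin T U}"

lemma borel_alg_euclidean: "borel_alg euclidean = borel"
  by (simp add: borel_alg_def borel_def)

definition borel_probs :: "'x topology \<Rightarrow> 'x measure set" where
  "borel_probs T = {\<mu>. prob_space \<mu> \<and> sets \<mu> = sets (borel_alg T)}"

definition borel_subprobs :: "'x topology \<Rightarrow> 'x measure set" where
  "borel_subprobs T = {\<mu>. emeasure \<mu> (topspace T) \<le> 1 \<and> sets \<mu> = sets (borel_alg T)}"

(* The N-fold power of T consists of the extensional functions on {..<N};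
   coordinates are numbered 0, ..., N - 1. *)
definition power_top :: "nat \<Rightarrow> 'x topology \<Rightarrow> (nat \<Rightarrow> 'x) topology" where
  "power_top N T = product_topology (\<lambda>_. T) {..<N}"

definition plans :: "nat \<Rightarrow> 'x topology \<Rightarrow> 'x measure \<Rightarrow> (nat \<Rightarrow> 'x) measure set" where
  "plans N T \<mu> = {P \<in> borel_probs (power_top N T).
     \<forall>i<N. distr P (borel_alg T) (\<lambda>x. x i) = \<mu>}"

definition pair_sum :: "nat \<Rightarrow> ('x \<Rightarrow> 'x \<Rightarrow> ennreal) \<Rightarrow> (nat \<Rightarrow> 'x) \<Rightarrow> ennreal" where
  "pair_sum N w x = (\<Sum>(i, j) \<in> {(i, j). i < j \<and> j < N}. w (x i) (x j))"

(* In ennreal, 1 / 0 = \<infinity>. *)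
definition coulomb :: "'a::real_normed_vector \<Rightarrow> 'a \<Rightarrow> ennreal" where
  "coulomb a b = 1 / ennreal (norm (a - b))"

(* In the Alexandroff compactification the added point is None. *)
fun coulomb_cpt :: "'a::real_normed_vector option \<Rightarrow> 'a option \<Rightarrow> ennreal" where
  "coulomb_cpt (Some a) (Some b) = coulomb a b"
| "coulomb_cpt _ _ = 0"

definition C_cost :: "nat \<Rightarrow> 'a::euclidean_space measure \<Rightarrow> ennreal" where
  "C_cost N \<rho> = (INF P \<in> plans N euclidean \<rho>. \<integral>\<^sup>+ x. pair_sum N coulomb x \<partial>P)"

definition weak_star_conv ::
  "(nat \<Rightarrow> 'a::euclidean_space measure) \<Rightarrow> 'a measure \<Rightarrow> bool" where
  "weak_star_conv \<rho>s \<rho> \<longleftrightarrow>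
     (\<forall>f :: 'a \<Rightarrow> real. continuous_on UNIV f \<and> (f \<longlongrightarrow> 0) at_infinity \<longrightarrow>
        (\<lambda>n. \<integral>x. f x \<partial>\<rho>s n) \<longlonglongrightarrow> (\<integral>x. f x \<partial>\<rho>))"

definition C_bar :: "nat \<Rightarrow> 'a::euclidean_space measure \<Rightarrow> ennreal" where
  "C_bar N \<rho> =
     (INF \<rho>s \<in> {\<rho>s. (\<forall>n. \<rho>s n \<in> borel_probs euclidean) \<and> weak_star_conv \<rho>s \<rho>}.
        liminf (\<lambda>n. C_cost N (\<rho>s n)))"

abbreviation cpt :: "'a::euclidean_space option topology" where
  "cpt \<equiv> Alexandroff_compactification euclidean"

(* LEAST, not INF: the value is specified only through an attained minimum. *)
definition C_tilde :: "nat \<Rightarrow> 'a::euclidean_space option measure \<Rightarrow> ennreal" where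
  "C_tilde N \<mu> =
     (LEAST v. v \<in> (\<lambda>P. \<integral>\<^sup>+ x. pair_sum N coulomb_cpt x \<partial>P) ` plans N cpt \<mu>)"

definition cpt_extend :: "'a::euclidean_space measure \<Rightarrow> 'a option measure" where
  "cpt_extend \<rho> = measure_of UNIV (sets (borel_alg cpt))
     (\<lambda>A. emeasure (distr \<rho> (borel_alg cpt) Some) A
        + (1 - emeasure \<rho> UNIV) * emeasure (return (borel_alg cpt) None) A)"

(* measure_of silently gives the zero measure when its argument is not a measure;
   the next lemma excludes this. *)
lemma emeasure_cpt_extend:
  assumes "A \<in> sets (borel_alg cpt)"
  shows "emeasure (cpt_extend \<rho>) A =
    emeasure (distr \<rho> (borel_alg cpt) Some) A
      + (1 - emeasure \<rho> UNIV) * emeasure (return (borel_alg cpt) None) A"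
proof (rule emeasure_measure_of[OF cpt_extend_def])
  have sp: "space (borel_alg (cpt :: 'a option topology)) = UNIV"
    by (simp add: borel_alg_def space_measure_of_conv flip: UNIV_option_conv)
  show "sets (borel_alg cpt) \<subseteq> Pow (UNIV :: 'a option set)" by simp
  have sa: "sigma_algebra (UNIV :: 'a option set) (sets (borel_alg cpt))"
    using sets.sigma_algebra_axioms[of "borel_alg (cpt :: 'a option topology)"] by (simp add: sp)
  have eq: "sets (cpt_extend \<rho>) = sets (borel_alg cpt)"
    unfolding cpt_extend_def using sa by (simp add: sigma_algebra.sigma_sets_eq)
  show "A \<in> sets (cpt_extend \<rho>)" using assms eq by simp
  show "positive (sets (cpt_extend \<rho>))
     (\<lambda>A. emeasure (distr \<rho> (borel_alg cpt) Some) A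
        + (1 - emeasure \<rho> UNIV) * emeasure (return (borel_alg cpt) None) A)"
    by (simp add: positive_def)
  show "countably_additive (sets (cpt_extend \<rho>))
     (\<lambda>A. emeasure (distr \<rho> (borel_alg cpt) Some) A
        + (1 - emeasure \<rho> UNIV) * emeasure (return (borel_alg cpt) None) A)"
    unfolding eq
    by (rule countably_additiveI)
      (simp add: suminf_add[symmetric] suminf_emeasure image_subset_iff del: emeasure_return)
qed

end

theory Submission
  imports Defs
begin

text \<open>For \<open>C_tilde \<le> C_bar\<close>, nearly optimal plans for the \<open>\<rho>\<^sub>n\<close> are regarded as plans on the compact
  space \<open>X\<^sup>N\<close>; a weak limit of them has marginals \<open>cpt_extend \<rho>\<close>, and the cost is lower semicontinuous.
  The same compactness shows that the minimum in \<open>C_tilde\<close> is attained. The weak limit is taken on the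
  real line: a Schoenberg curve gives a continuous surjection of \<open>\<real>\<close> onto \<open>X\<^sup>N\<close> with a Borel right inverse
  valued in \<open>[0, 1]\<close>, so that Helly's selection theorem and Skorohod's representation apply.

  For \<open>C_bar \<le> C_tilde\<close>, each coordinate of an optimal plan that is \<open>\<omega>\<close> or has norm above \<open>R\<close> is moved to
  one of \<open>N\<close> points at mutual distance and distance from the ball of radius \<open>R\<close> at least \<open>R\<close>. This
  raises each pair cost by at most \<open>1 / R\<close>.\<close>

section \<open>The Schoenberg curve and its Borel section\<close>

text \<open>The right inverse may be discontinuous because it is applied only to the given plans,
  turning them into laws on [0, 1], which are automatically tight. The limit law is carried back by
  the curve alone, so the curve is the map that has to be continuous. Skorohod's representation
  replaces weak convergence by pointwise convergence: marginals pass to the limit by dominated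
  convergence, and lower semicontinuity of the cost becomes Fatou's lemma. Test functions vanishing
  at infinity do not see mass at \<omega>, but a probability on X is determined by its part on R^d,
  so the limit marginals are still identified. Nothing better than lower semicontinuity is available
  at \<omega>: two points may escape to infinity while staying close together, and their cost is
  lost in the limit. In the opposite direction the obstacle is that all N marginals must coincide. A
  fixed assignment of far points to coordinates would keep the far coordinates apart but give the
  coordinates different laws, so the assignment is randomised.\<close>

definition bump :: "real \<Rightarrow> real" where
  "bump t = min 1 (max 0 (1 / 2 - cos (pi * t)))"

text \<open>The binary digit of weight 2^-(k+1). At y = 1 every digit is 0, so the expansion
  represents y only on the half-open interval [0, 1); this is where the strict upper bounds below
  come from.\<close>

definition bin_digit :: "nat \<Rightarrow> real \<Rightarrow> real" where
  "bin_digit k y = real_of_int (\<lfloor>2 ^ Suc k * y\<rfloor> - 2 * \<lfloor>2 ^ k * y\<rfloor>)"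

text \<open>Schoenberg's space-filling curve, with a clipped cosine in place of the usual piecewise
  linear wave. Component \<open>j\<close> reads the ternary places
  \<open>prod_encode (j, k)\<close>, so a single Cantor point stores countably many binary
  expansions.\<close>

definition schoenberg :: "nat \<Rightarrow> real \<Rightarrow> real" where
  "schoenberg j t = (\<Sum>k. (1 / 2) ^ Suc k * bump (3 ^ prod_encode (j, k) * t))"

definition cantor_pt :: "(nat \<Rightarrow> real) \<Rightarrow> real" where
  "cantor_pt a = (\<Sum>i. 2 * a i / 3 ^ Suc i)"

definition schoenberg_section :: "(nat \<Rightarrow> real) \<Rightarrow> real" where
  "schoenberg_section x =
     cantor_pt (\<lambda>i. case prod_decode i of (j, k) \<Rightarrow> bin_digit k (x j))"

lemma bump_bounds: "0 \<le> bump t" "bump t \<le> 1"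
  by (auto simp: bump_def)

lemma bump_even_shift: "bump (2 * of_int n + r) = bump r"
proof -
  have "pi * (2 * of_int n + r) = pi * r + (2 * of_int n) * pi"
    by (simp add: algebra_simps)
  moreover have "cos (2 * of_int n * pi) = 1" "sin (2 * of_int n * pi) = 0"
    using cos_int_2pin[of n] sin_int_2pin[of n] by (simp_all add: mult_ac)
  ultimately show ?thesis
    by (simp add: bump_def cos_add del: mult.assoc)
qed

text \<open>The thirds match the constants in \<open>bump\<close>: cos (pi r) falls to 1/2 at r =
  1/3 and to -1/2 at r = 2/3, so the clipping makes \<open>bump\<close> constant on both outer
  thirds of [0, 1].\<close>

lemma bump_eq_0:
  assumes "0 \<le> r" "r \<le> 1 / 3"
  shows "bump r = 0"
proof -
  have "cos (pi / 3) \<le> cos (pi * r)"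
    using assms by (intro cos_monotone_0_pi_le) (auto simp: field_simps)
  then show ?thesis
    by (simp add: bump_def cos_60)
qed

lemma bump_eq_1:
  assumes "2 / 3 \<le> r" "r \<le> 1"
  shows "bump r = 1"
proof -
  have "cos (pi * r) \<le> cos (2 * pi / 3)"
    using assms by (intro cos_monotone_0_pi_le) (auto simp: field_simps)
  also have "2 * pi / 3 = pi - pi / 3"
    by simp
  also have "cos (pi - pi / 3) = - 1 / 2"
    by (simp only: cos_pi_minus cos_60)
  finally show ?thesis
    by (simp add: bump_def)
qed

lemma bin_digit_cases: "bin_digit k y = 0 \<or> bin_digit k y = 1"
proof -
  define z where "z = 2 ^ k * y"
  have *: "2 ^ Suc k * y = 2 * z"
    by (simp add: z_def)
  have "\<lfloor>2 * z\<rfloor> - 2 * \<lfloor>z\<rfloor> = 0 \<or> \<lfloor>2 * z\<rfloor> - 2 * \<lfloor>z\<rfloor> = 1"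
    by linarith
  then show ?thesis
    unfolding bin_digit_def * z_def[symmetric] by auto
qed

text \<open>The partial sums telescope to the dyadic truncation of \<open>y\<close>, because its
  integer part is 0.\<close>

lemma bin_digit_sums:
  assumes "0 \<le> y" "y < 1"
  shows "(\<lambda>k. (1 / 2) ^ Suc k * bin_digit k y) sums y"
proof -
  have "(\<Sum>k<n. (1 / 2) ^ Suc k * bin_digit k y) = \<lfloor>2 ^ n * y\<rfloor> / 2 ^ n" for n
  proof (induction n)
    case 0
    have "\<lfloor>y\<rfloor> = 0" using assms by linarith
    then show ?case by simp
  next
    case (Suc n)
    then show ?case
      by (simp add: bin_digit_def field_simps power_divide)
  qed
  moreover have "(\<lambda>n. \<lfloor>2 ^ n * y\<rfloor> / 2 ^ n) \<longlonglongrightarrow> y"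
  proof (rule tendsto_sandwich)
    show "\<forall>\<^sub>F n in sequentially. y - (1 / 2) ^ n \<le> \<lfloor>2 ^ n * y\<rfloor> / 2 ^ n"
    proof (intro always_eventually allI)
      fix n
      have "2 ^ n * y - 1 \<le> \<lfloor>2 ^ n * y\<rfloor>" by linarith
      then have "(2 ^ n * y - 1) / 2 ^ n \<le> \<lfloor>2 ^ n * y\<rfloor> / 2 ^ n"
        by (intro divide_right_mono) auto
      then show "y - (1 / 2) ^ n \<le> \<lfloor>2 ^ n * y\<rfloor> / 2 ^ n"
        by (simp add: diff_divide_distrib power_divide)
    qed
    show "\<forall>\<^sub>F n in sequentially. \<lfloor>2 ^ n * y\<rfloor> / 2 ^ n \<le> y"
    proof (intro always_eventually allI)
      fix n
      have "\<lfloor>2 ^ n * y\<rfloor> \<le> 2 ^ n * y" by linarith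
      then show "\<lfloor>2 ^ n * y\<rfloor> / 2 ^ n \<le> y"
        by (simp add: field_simps)
    qed
    have "(\<lambda>n. y - (1 / 2) ^ n) \<longlonglongrightarrow> y - 0"
      by (intro tendsto_intros LIMSEQ_power_zero) auto
    then show "(\<lambda>n. y - (1 / 2) ^ n) \<longlonglongrightarrow> y" by simp
  qed auto
  ultimately show ?thesis
    unfolding sums_def by simp
qed

lemma geometric_third_sums: "(\<lambda>i. 2 / 3 ^ Suc i :: real) sums 1"
proof -
  have "(\<lambda>i. 2 / 3 * (1 / 3) ^ i :: real) sums (2 / 3 * (1 / (1 - 1 / 3)))"
    by (intro sums_mult geometric_sums) auto
  then show ?thesis
    by (simp add: power_divide)
qed

context
  fixes a :: "nat \<Rightarrow> real"
  assumes a: "\<And>i. a i = 0 \<or> a i = 1"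
begin

lemma cantor_summable: "summable (\<lambda>i. 2 * a (i + n) / 3 ^ Suc i)"
proof (rule summable_comparison_test')
  show "summable (\<lambda>i. 2 / 3 ^ Suc i :: real)"
    using geometric_third_sums by (rule sums_summable)
  show "norm (2 * a (i + n) / 3 ^ Suc i) \<le> 2 / 3 ^ Suc i" for i
    using a[of "i + n"] by auto
qed

lemma cantor_pt_bounds: "0 \<le> cantor_pt (\<lambda>i. a (i + n))" "cantor_pt (\<lambda>i. a (i + n)) \<le> 1"
proof -
  have *: "0 \<le> a i" "a i \<le> 1" for i
    using a[of i] by auto
  show "0 \<le> cantor_pt (\<lambda>i. a (i + n))"
    unfolding cantor_pt_def by (intro suminf_nonneg cantor_summable) (simp add: *)
  have "cantor_pt (\<lambda>i. a (i + n)) \<le> (\<Sum>i. 2 / 3 ^ Suc i)"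
    unfolding cantor_pt_def
    by (intro suminf_le cantor_summable sums_summable[OF geometric_third_sums])
       (simp add: * divide_right_mono)
  then show "cantor_pt (\<lambda>i. a (i + n)) \<le> 1"
    using sums_unique[OF geometric_third_sums] by simp
qed

lemma cantor_pt_shift:
  "3 * cantor_pt (\<lambda>i. a (i + n)) = 2 * a n + cantor_pt (\<lambda>i. a (i + Suc n))"
proof -
  have "cantor_pt (\<lambda>i. a (i + n)) = (\<Sum>i. 2 * a (Suc i + n) / 3 ^ Suc (Suc i)) + 2 * a n / 3"
    unfolding cantor_pt_def
    using suminf_split_head[OF cantor_summable[of n]] by simp
  also have "(\<Sum>i. 2 * a (Suc i + n) / 3 ^ Suc (Suc i)) =
      (\<Sum>i. 1 / 3 * (2 * a (i + Suc n) / 3 ^ Suc i))"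
    by (rule suminf_cong) simp
  also have "\<dots> = 1 / 3 * cantor_pt (\<lambda>i. a (i + Suc n))"
    unfolding cantor_pt_def by (rule suminf_mult[OF cantor_summable])
  finally show ?thesis by simp
qed

text \<open>Multiplying by 3 shifts the ternary expansion and releases the leading digit
  \<open>2 * a n\<close>. What accumulates in front is an even integer, exactly what the period 2 of
  \<open>bump\<close> ignores.\<close>

lemma power_mult_cantor_pt:
  "\<exists>m::int. 3 ^ n * cantor_pt a = 2 * of_int m + cantor_pt (\<lambda>i. a (i + n))"
proof (induction n)
  case 0
  show ?case by (rule exI[of _ 0]) simp
next
  case (Suc n)
  then obtain m :: int where m: "3 ^ n * cantor_pt a = 2 * of_int m + cantor_pt (\<lambda>i. a (i + n))"
    by blast
  obtain c :: int where c: "a n = of_int c"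
    using a[of n] by (metis of_int_0 of_int_1)
  have "3 ^ Suc n * cantor_pt a = 3 * (3 ^ n * cantor_pt a)" by simp
  also have "\<dots> = 2 * of_int (3 * m + c) + cantor_pt (\<lambda>i. a (i + Suc n))"
    unfolding m using cantor_pt_shift[of n] c by simp
  finally show ?case by blast
qed

text \<open>With digits 0 and 2 only, the remaining tail avoids the open middle third: it lies in
  [0, 1/3] or [2/3, 1] according to \<open>a n\<close>, and \<open>bump\<close> is constant
  there.\<close>

lemma bump_power_mult_cantor_pt: "bump (3 ^ n * cantor_pt a) = a n"
proof -
  define r where "r = cantor_pt (\<lambda>i. a (i + n))"
  obtain m :: int where m: "3 ^ n * cantor_pt a = 2 * of_int m + r"
    using power_mult_cantor_pt r_def by blast
  have r: "r = 2 / 3 * a n + cantor_pt (\<lambda>i. a (i + Suc n)) / 3"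
    using cantor_pt_shift[of n] by (simp add: r_def)
  have "bump r = a n"
    using a[of n]
  proof
    assume "a n = 0"
    then show ?thesis
      using r cantor_pt_bounds[of "Suc n"] by (simp add: bump_eq_0)
  next
    assume "a n = 1"
    then show ?thesis
      using r cantor_pt_bounds[of "Suc n"] by (simp add: bump_eq_1)
  qed
  then show ?thesis
    by (simp add: m bump_even_shift)
qed

end

lemma continuous_on_schoenberg: "continuous_on UNIV (schoenberg j)"
proof -
  have b: "\<forall>\<^sub>F n in sequentially. \<forall>t\<in>UNIV. continuous_on UNIV
      (\<lambda>t. \<Sum>k<n. (1 / 2) ^ Suc k * bump (3 ^ prod_encode (j, k) * t))"
    unfolding bump_def by (intro always_eventually allI ballI continuous_intros)
  have "uniform_limit UNIV (\<lambda>n t. \<Sum>k<n. (1 / 2) ^ Suc k * bump (3 ^ prod_encode (j, k) * t))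
      (\<lambda>t. \<Sum>k. (1 / 2) ^ Suc k * bump (3 ^ prod_encode (j, k) * t)) sequentially"
  proof (rule Weierstrass_m_test)
    show "norm ((1 / 2) ^ Suc k * bump (3 ^ prod_encode (j, k) * t)) \<le> (1 / 2) ^ Suc k" for k t
      using bump_bounds[of "3 ^ prod_encode (j, k) * t"] by (simp add: abs_mult)
    have "summable (\<lambda>k. 1 / 2 * (1 / 2) ^ k :: real)"
      by (intro summable_mult summable_geometric) simp
    then show "summable (\<lambda>k. (1 / 2) ^ Suc k :: real)"
      by simp
  qed
  then show ?thesis
    unfolding schoenberg_def[abs_def]
    by (rule uniform_limit_theorem[rotated]) (use b in auto)
qed

lemma schoenberg_section_bounds: "0 \<le> schoenberg_section x" "schoenberg_section x \<le> 1"
  using cantor_pt_bounds[of "\<lambda>i. case prod_decode i of (j, k) \<Rightarrow> bin_digit k (x j)" 0]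
    bin_digit_cases
  by (auto simp: schoenberg_section_def split: prod.splits)

text \<open>The interleaved digits are 0 or 1 for arbitrary reals by \<open>bin_digit_cases\<close>,
  so the Cantor point can always be decoded; the bounds on \<open>x j\<close> serve to resum its own
  expansion.\<close>

lemma schoenberg_section:
  assumes "0 \<le> x j" "x j < 1"
  shows "schoenberg j (schoenberg_section x) = x j"
proof -
  let ?a = "\<lambda>i. case prod_decode i of (j, k) \<Rightarrow> bin_digit k (x j)"
  have "bump (3 ^ prod_encode (j, k) * schoenberg_section x) = bin_digit k (x j)" for k
    unfolding schoenberg_section_def
    by (subst bump_power_mult_cantor_pt)
       (auto simp: bin_digit_cases split: prod.splits)
  then show ?thesis
    unfolding schoenberg_def using sums_unique[OF bin_digit_sums[OF assms]] by simp
qed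

lemma measurable_schoenberg_section [measurable]:
  assumes [measurable]: "\<And>j. (\<lambda>x. F x j) \<in> borel_measurable M"
  shows "(\<lambda>x. schoenberg_section (F x)) \<in> borel_measurable M"
proof -
  have [measurable]: "(\<lambda>x. case prod_decode i of (j, k) \<Rightarrow> bin_digit k (F x j)) \<in> borel_measurable M" for i
    by (cases "prod_decode i") (simp add: bin_digit_def)
  show ?thesis
    unfolding schoenberg_section_def cantor_pt_def by measurable
qed

section \<open>Borel sets of the compactification\<close>

lemma space_borel_alg [simp]: "space (borel_alg T) = topspace T"
  by (simp add: borel_alg_def space_measure_of_conv)

lemma sets_borel_alg: "sets (borel_alg T) = sigma_sets (topspace T) {U. openin T U}"
  unfolding borel_alg_def by (intro sets_measure_of) (auto dest: openin_subset)

lemma openin_sets_borel_alg: "openin T U \<Longrightarrow> U \<in> sets (borel_alg T)"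
  by (auto simp: sets_borel_alg)

lemma measurable_borel_algI:
  assumes "f \<in> space M \<rightarrow> topspace T"
    and "\<And>U. openin T U \<Longrightarrow> f -` U \<inter> space M \<in> sets M"
  shows "f \<in> M \<rightarrow>\<^sub>M borel_alg T"
  unfolding borel_alg_def
  by (rule measurable_measure_of) (use assms in \<open>auto dest: openin_subset\<close>)

lemma measurable_continuous_map:
  assumes "continuous_map S T f"
  shows "f \<in> borel_alg S \<rightarrow>\<^sub>M borel_alg T"
proof (rule measurable_borel_algI)
  show "f \<in> space (borel_alg S) \<rightarrow> topspace T"
    using assms by (auto simp: continuous_map_def)
  fix U assume "openin T U"
  then have "openin S {x \<in> topspace S. f x \<in> U}"
    using assms by (auto simp: continuous_map_def)
  also have "{x \<in> topspace S. f x \<in> U} = f -` U \<inter> space (borel_alg S)"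
    by auto
  finally show "f -` U \<inter> space (borel_alg S) \<in> sets (borel_alg S)"
    by (rule openin_sets_borel_alg)
qed

lemma measurable_power_top_component:
  "i < N \<Longrightarrow> (\<lambda>x. x i) \<in> borel_alg (power_top N T) \<rightarrow>\<^sub>M borel_alg T"
  by (rule measurable_continuous_map)
     (auto simp: power_top_def intro: continuous_map_product_projection)

lemma topspace_cpt [simp]: "topspace (cpt :: 'a::euclidean_space option topology) = UNIV"
  by (simp add: UNIV_option_conv)

lemma insert_None_range_Some [simp]: "insert None (range Some) = UNIV"
  by (rule UNIV_option_conv[symmetric])

lemma measurable_Some: "Some \<in> borel \<rightarrow>\<^sub>M borel_alg (cpt :: 'a::euclidean_space option topology)"
  using measurable_continuous_map[OF continuous_map_Some[of "euclidean :: 'a topology"]]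
  by (simp add: borel_alg_euclidean)

lemma image_Some_sets_cpt:
  assumes "B \<in> sets (borel :: 'a::euclidean_space measure)"
  shows "Some ` B \<in> sets (borel_alg cpt)"
proof -
  have "B \<in> sigma_sets UNIV {S. open S}"
    using assms by (simp add: borel_def)
  then show ?thesis
  proof induction
    case (Basic U)
    then show ?case by (intro openin_sets_borel_alg) simp
  next
    case Empty
    then show ?case by simp
  next
    case (Compl U)
    \<comment> \<open>Complements must be taken inside \<open>range Some\<close>, which is itself
      open in the compactification.\<close>
    have "range Some \<in> sets (borel_alg (cpt :: 'a option topology))"
      by (intro openin_sets_borel_alg) simp
    with Compl.IH have "range Some - Some ` U \<in> sets (borel_alg cpt)"
      by (rule sets.Diff[rotated])
    also have "range Some - Some ` U = Some ` (UNIV - U)"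
      by auto
    finally show ?case .
  next
    case (Union U)
    then show ?case
      by (subst image_UN) (intro sets.countable_UN, auto)
  qed
qed

lemma None_sets_cpt: "{None} \<in> sets (borel_alg (cpt :: 'a::euclidean_space option topology))"
proof -
  have "space (borel_alg cpt) - Some ` (UNIV :: 'a set) \<in> sets (borel_alg cpt)"
    by (intro sets.compl_sets image_Some_sets_cpt) simp
  also have "space (borel_alg cpt) - Some ` (UNIV :: 'a set) = {None}"
    using notin_range_Some by auto
  finally show ?thesis .
qed

text \<open>A preimage splits into the image of a Borel set and possibly the Borel point
  \<open>None\<close>. Measurability on X thereby reduces to measurability on R^d.\<close>

lemma measurable_cpt_iff:
  fixes f :: "'a::euclidean_space option \<Rightarrow> 'b"
  shows "f \<in> borel_alg cpt \<rightarrow>\<^sub>M M \<longleftrightarrow> (\<lambda>x. f (Some x)) \<in> borel \<rightarrow>\<^sub>M M \<and> f None \<in> space M"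
proof (intro iffI conjI)
  assume f: "f \<in> borel_alg cpt \<rightarrow>\<^sub>M M"
  show "(\<lambda>x. f (Some x)) \<in> borel \<rightarrow>\<^sub>M M"
    by (rule measurable_compose[OF measurable_Some f])
  show "f None \<in> space M"
    using measurable_space[OF f, of None] by simp
next
  assume *: "(\<lambda>x. f (Some x)) \<in> borel \<rightarrow>\<^sub>M M \<and> f None \<in> space M"
  show "f \<in> borel_alg cpt \<rightarrow>\<^sub>M M"
  proof (rule measurableI)
    show "f x \<in> space M" if "x \<in> space (borel_alg cpt)" for x
      using * measurable_space[of "\<lambda>x. f (Some x)" borel M] by (cases x) auto
    fix A assume A: "A \<in> sets M"
    have "Some ` ((\<lambda>x. f (Some x)) -` A \<inter> space borel) \<in> sets (borel_alg (cpt :: 'a option topology))"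
      using * A by (intro image_Some_sets_cpt measurable_sets) auto
    moreover have "p \<in> f -` A \<inter> space (borel_alg cpt) \<longleftrightarrow>
        p \<in> Some ` ((\<lambda>x. f (Some x)) -` A \<inter> space borel) \<union> (if f None \<in> A then {None} else {})" for p
      by (cases p) auto
    then have "f -` A \<inter> space (borel_alg cpt) =
        Some ` ((\<lambda>x. f (Some x)) -` A \<inter> space borel) \<union> (if f None \<in> A then {None} else {})"
      by blast
    ultimately show "f -` A \<inter> space (borel_alg cpt) \<in> sets (borel_alg cpt)"
      using None_sets_cpt by (auto intro: sets.insert_in_sets)
  qed
qed

section \<open>A curve onto the powers of the compactification\<close>

text \<open>\<open>cube_embed\<close> is an open embedding into \<open>(0, 1)\<^sup>d\<close>; collapsing the complement of its range to a
  point gives the compactification, so any point outside the range, such as \<open>0\<close>, is a code for \<open>\<omega>\<close>.\<close>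

definition cube_coord :: "'a::euclidean_space \<Rightarrow> 'a \<Rightarrow> real" where
  "cube_coord b x = 1 / 2 + arctan (x \<bullet> b) / pi"

definition cube_embed :: "'a::euclidean_space \<Rightarrow> 'a" where
  "cube_embed x = (\<Sum>b\<in>Basis. cube_coord b x *\<^sub>R b)"

lemma cube_coord_bounds: "0 < cube_coord b x" "cube_coord b x < 1"
  using arctan_bounded[of "x \<bullet> b"] by (auto simp: cube_coord_def field_simps)

lemma cube_embed_inner: "b \<in> Basis \<Longrightarrow> cube_embed x \<bullet> b = cube_coord b x"
  by (simp add: cube_embed_def)

lemma inj_cube_embed: "inj cube_embed"
proof (rule injI, rule euclidean_eqI)
  fix x y b :: 'a
  assume "cube_embed x = cube_embed y" "b \<in> Basis"
  then have "cube_coord b x = cube_coord b y"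
    by (metis cube_embed_inner)
  then show "x \<bullet> b = y \<bullet> b"
    by (simp add: cube_coord_def arctan_eq_iff)
qed

lemma continuous_on_cube_embed: "continuous_on S cube_embed"
  unfolding cube_embed_def cube_coord_def by (intro continuous_intros) simp

lemma zero_notin_range_cube_embed: "(0 :: 'a::euclidean_space) \<notin> range cube_embed"
proof
  assume "(0 :: 'a) \<in> range cube_embed"
  then obtain x :: 'a where x: "cube_embed x = 0" by auto
  obtain b :: 'a where "b \<in> Basis" using nonempty_Basis by blast
  then show False
    using cube_embed_inner[of b x] cube_coord_bounds(1)[of b x] x by simp
qed

definition cpt_of_cube :: "'a::euclidean_space \<Rightarrow> 'a option" where
  "cpt_of_cube y = (if y \<in> range cube_embed then Some (inv cube_embed y) else None)"

lemma cpt_of_cube_embed [simp]: "cpt_of_cube (cube_embed x) = Some x"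
  by (simp add: cpt_of_cube_def inj_cube_embed)

lemma cpt_of_cube_zero [simp]: "cpt_of_cube 0 = None"
  by (simp add: cpt_of_cube_def zero_notin_range_cube_embed)

lemma cpt_of_cube_eq_Some: "cpt_of_cube y = Some x \<longleftrightarrow> y = cube_embed x"
  by (auto simp: cpt_of_cube_def inv_f_f[OF inj_cube_embed])

text \<open>The two kinds of open sets need different arguments: those avoiding \<open>None\<close>
  pull back to open sets by invariance of domain, and the others pull back to complements of compact
  sets.\<close>

lemma continuous_map_cpt_of_cube: "continuous_map euclidean cpt cpt_of_cube"
  unfolding continuous_map_def
proof (intro conjI allI impI)
  show "cpt_of_cube \<in> topspace euclidean \<rightarrow> topspace (cpt :: 'a option topology)"
    unfolding topspace_cpt by simp
  fix U :: "'a option set" assume "openin cpt U"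
  then consider V where "open V" "U = Some ` V"
    | K where "compact K" "U = insert None (Some ` (- K))"
    unfolding openin_Alexandroff_compactification
    by (auto simp: Compl_eq_Diff_UNIV)
  then show "openin euclidean {x \<in> topspace euclidean. cpt_of_cube x \<in> U}"
  proof cases
    case 1
    have "{x. cpt_of_cube x \<in> U} = cube_embed ` V"
      using 1(2) by (auto simp: cpt_of_cube_eq_Some)
    moreover have "open (cube_embed ` V)"
      using 1(1) inj_cube_embed continuous_on_cube_embed
      by (intro invariance_of_domain) (auto intro: inj_on_subset)
    ultimately show ?thesis by simp
  next
    case 2
    have "cpt_of_cube x \<in> U \<longleftrightarrow> x \<notin> cube_embed ` K" for x
      using 2(2)
      by (cases "x \<in> range cube_embed")
         (auto simp: cpt_of_cube_def inv_f_f[OF inj_cube_embed] inj_eq[OF inj_cube_embed])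
    then have "{x. cpt_of_cube x \<in> U} = - cube_embed ` K"
      by auto
    moreover have "closed (cube_embed ` K)"
      using 2(1) continuous_on_cube_embed by (intro compact_imp_closed compact_continuous_image)
    ultimately show ?thesis by (simp add: open_Compl)
  qed
qed

text \<open>Different coordinates \<open>i\<close> use disjoint families of Schoenberg components,
  so one parameter \<open>t\<close> can prescribe all coordinates of a tuple independently.\<close>

definition cpt_curve :: "nat \<Rightarrow> real \<Rightarrow> 'a::euclidean_space option" where
  "cpt_curve i t =
     cpt_of_cube (\<Sum>b\<in>Basis. schoenberg (prod_encode (i, to_nat_on Basis b)) t *\<^sub>R b)"

text \<open>The zero vector codes \<omega>: it lies outside the range of \<open>cube_embed\<close>,
  yet its entries lie in [0, 1), as \<open>schoenberg_section\<close> requires.\<close>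

definition cpt_code :: "nat \<Rightarrow> (nat \<Rightarrow> 'a::euclidean_space option) \<Rightarrow> real" where
  "cpt_code N x = schoenberg_section (\<lambda>n. case prod_decode n of (i, l) \<Rightarrow>
     if i < N then case x i of None \<Rightarrow> 0 | Some a \<Rightarrow> cube_coord (from_nat_into Basis l) a else 0)"

lemma continuous_map_cpt_curve: "continuous_map euclidean cpt (cpt_curve i)"
proof -
  have "continuous_on UNIV (\<lambda>t. \<Sum>b\<in>Basis. schoenberg (prod_encode (i, to_nat_on Basis b)) t *\<^sub>R b)"
    by (intro continuous_intros continuous_on_schoenberg)
  then have "continuous_map euclidean euclidean
      (\<lambda>t. \<Sum>b\<in>Basis. schoenberg (prod_encode (i, to_nat_on Basis b)) t *\<^sub>R b)"
    by simp
  from continuous_map_compose[OF this continuous_map_cpt_of_cube] show ?thesis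
    by (simp add: cpt_curve_def[abs_def] o_def)
qed

lemma cpt_code_bounds: "0 \<le> cpt_code N x" "cpt_code N x \<le> 1"
  by (simp_all add: cpt_code_def schoenberg_section_bounds)

lemma cpt_curve_code:
  assumes "i < N"
  shows "cpt_curve i (cpt_code N x) = x i"
proof -
  have "schoenberg (prod_encode (i, to_nat_on Basis b)) (cpt_code N x) =
      (case x i of None \<Rightarrow> 0 | Some a \<Rightarrow> cube_coord b a)" if "b \<in> Basis" for b
    using that assms unfolding cpt_code_def
    by (subst schoenberg_section)
       (auto split: prod.splits option.splits simp: cube_coord_bounds less_imp_le
          from_nat_into_to_nat_on countable_finite)
  then have "(\<Sum>b\<in>Basis. schoenberg (prod_encode (i, to_nat_on Basis b)) (cpt_code N x) *\<^sub>R b) =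
      (\<Sum>b\<in>Basis. (case x i of None \<Rightarrow> 0 | Some a \<Rightarrow> cube_coord b a) *\<^sub>R b)"
    by (intro sum.cong) auto
  also have "\<dots> = (case x i of None \<Rightarrow> 0 | Some a \<Rightarrow> cube_embed a)"
    by (simp add: cube_embed_def split: option.splits)
  finally show ?thesis
    by (simp add: cpt_curve_def split: option.splits)
qed

lemma measurable_cpt_code:
  "cpt_code N \<in> borel_measurable (borel_alg (power_top N (cpt :: 'a::euclidean_space option topology)))"
  unfolding cpt_code_def[abs_def]
proof (rule measurable_schoenberg_section)
  fix n
  obtain i l where n: "prod_decode n = (i, l)" by fastforce
  have c: "(\<lambda>p. case p of None \<Rightarrow> 0 | Some (a::'a) \<Rightarrow> cube_coord (from_nat_into Basis l) a)
      \<in> borel_measurable (borel_alg cpt)"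
    by (simp add: measurable_cpt_iff cube_coord_def)
  have "(\<lambda>x. case x i of None \<Rightarrow> 0 | Some (a::'a) \<Rightarrow> cube_coord (from_nat_into Basis l) a)
      \<in> borel_measurable (borel_alg (power_top N cpt))" if "i < N"
    by (rule measurable_compose[OF measurable_power_top_component[OF that] c])
  then show "(\<lambda>x. case prod_decode n of (i, l) \<Rightarrow>
      if i < N then case x i of None \<Rightarrow> 0 | Some (a::'a) \<Rightarrow> cube_coord (from_nat_into Basis l) a else 0)
      \<in> borel_measurable (borel_alg (power_top N cpt))"
    by (cases "i < N") (simp_all add: n)
qed

section \<open>Convergence and measures on the compactification\<close>

definition cpt_ext :: "('a \<Rightarrow> real) \<Rightarrow> 'a option \<Rightarrow> real" where
  "cpt_ext f p = (case p of None \<Rightarrow> 0 | Some x \<Rightarrow> f x)"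

lemma cpt_ext_simps [simp]: "cpt_ext f None = 0" "cpt_ext f (Some x) = f x"
  by (simp_all add: cpt_ext_def)

lemma measurable_cpt_ext [measurable]:
  fixes f :: "'a::euclidean_space \<Rightarrow> real"
  assumes "f \<in> borel_measurable borel"
  shows "cpt_ext f \<in> borel_measurable (borel_alg cpt)"
  using assms by (simp add: measurable_cpt_iff)

lemma measurable_the [measurable]: "the \<in> borel_alg cpt \<rightarrow>\<^sub>M (borel :: 'a::euclidean_space measure)"
  by (simp add: measurable_cpt_iff)

lemma vanishing_at_infinity_bounded:
  fixes f :: "'a::euclidean_space \<Rightarrow> real"
  assumes "continuous_on UNIV f" "(f \<longlongrightarrow> 0) at_infinity"
  obtains B where "\<And>x. \<bar>f x\<bar> \<le> B"
proof -
  from assms(2) have "\<forall>\<^sub>F x in at_infinity. dist (f x) 0 < 1"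
    by (rule tendstoD) simp
  then obtain R where R: "\<And>x. R \<le> norm x \<Longrightarrow> \<bar>f x\<bar> < 1"
    by (auto simp: eventually_at_infinity)
  have "bounded (f ` cball 0 R)"
    by (intro compact_imp_bounded compact_continuous_image continuous_on_subset[OF assms(1)]) auto
  then obtain B where B: "\<And>x. x \<in> cball 0 R \<Longrightarrow> \<bar>f x\<bar> \<le> B"
    by (fastforce simp: bounded_iff)
  show ?thesis
  proof (rule that[of "max B 1"])
    show "\<bar>f x\<bar> \<le> max B 1" for x
      using R[of x] B[of x] by (cases "norm x \<le> R") (auto simp: le_max_iff_disj)
  qed
qed

lemma limitin_cpt_Some:
  assumes "limitin cpt xs (Some a) F"
  shows "\<forall>\<^sub>F n in F. xs n \<noteq> None" "((\<lambda>n. the (xs n)) \<longlongrightarrow> a) F"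
proof -
  have *: "\<forall>\<^sub>F n in F. xs n \<in> Some ` V" if "open V" "a \<in> V" for V
    using assms that by (simp add: limitin_def)
  show "\<forall>\<^sub>F n in F. xs n \<noteq> None"
    using *[of UNIV] by (auto elim: eventually_mono)
  show "((\<lambda>n. the (xs n)) \<longlongrightarrow> a) F"
    by (rule topological_tendstoI) (use * in \<open>force elim: eventually_mono\<close>)
qed

text \<open>This is continuity on X of the extension by 0, phrased along limits for use in dominated
  convergence. At \<open>None\<close> it holds because complements of closed balls give
  neighbourhoods of \<omega>.\<close>

lemma tendsto_cpt_ext:
  fixes f :: "'a::euclidean_space \<Rightarrow> real"
  assumes f: "continuous_on UNIV f" "(f \<longlongrightarrow> 0) at_infinity" and lim: "limitin cpt xs p F"
  shows "((\<lambda>n. cpt_ext f (xs n)) \<longlongrightarrow> cpt_ext f p) F"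
proof (cases p)
  case (Some a)
  then have *: "\<forall>\<^sub>F n in F. xs n \<noteq> None" "((\<lambda>n. the (xs n)) \<longlongrightarrow> a) F"
    using limitin_cpt_Some lim by blast+
  have "((\<lambda>n. f (the (xs n))) \<longlongrightarrow> f a) F"
    using f(1) *(2) continuous_on_tendsto_compose[of UNIV f] by auto
  moreover have "\<forall>\<^sub>F n in F. f (the (xs n)) = cpt_ext f (xs n)"
    using *(1) by eventually_elim auto
  ultimately show ?thesis
    using Some by (auto intro: Lim_transform_eventually)
next
  case None
  show ?thesis
    unfolding None cpt_ext_simps
  proof (rule tendstoI)
    fix e :: real assume "0 < e"
    then have "\<forall>\<^sub>F x in at_infinity. dist (f x) 0 < e"
      using f(2) by (intro tendstoD)
    then obtain R where R: "\<And>x. R \<le> norm x \<Longrightarrow> \<bar>f x\<bar> < e"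
      by (auto simp: eventually_at_infinity)
    have "openin cpt (insert None (Some ` (- cball (0::'a) R)))"
      unfolding openin_Alexandroff_compactification
      by (intro disjI2 exI[of _ "cball 0 R"]) auto
    then have "\<forall>\<^sub>F n in F. xs n \<in> insert None (Some ` (- cball (0::'a) R))"
      using lim None unfolding limitin_def by blast
    then show "\<forall>\<^sub>F n in F. dist (cpt_ext f (xs n)) 0 < e"
      by eventually_elim (use R \<open>0 < e\<close> in auto)
  qed
qed

section \<open>Lower semicontinuity and measurability of the pair cost on X\<close>

lemma coulomb_cpt_eq: "coulomb_cpt p q = (if p = None \<or> q = None then 0 else coulomb (the p) (the q))"
  by (cases p; cases q) auto

text \<open>The diagonal is included: \<open>inverse\<close> is continuous on all of
  \<open>ennreal\<close>, with value \<infinity> at 0.\<close>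

lemma tendsto_coulomb:
  assumes "(f \<longlongrightarrow> a) F" "(g \<longlongrightarrow> b) F"
  shows "((\<lambda>n. coulomb (f n) (g n)) \<longlongrightarrow> coulomb a b) F"
proof -
  have "continuous_on UNIV (\<lambda>x::ennreal. inverse x)"
    by (intro continuous_intros)
  moreover have "((\<lambda>n. ennreal (norm (f n - g n))) \<longlongrightarrow> ennreal (norm (a - b))) F"
    by (intro tendsto_intros assms)
  ultimately show ?thesis
    unfolding coulomb_def divide_ennreal_def mult_1
    by (intro continuous_on_tendsto_compose[of UNIV inverse]) auto
qed

text \<open>If a limit is \<omega>, the left side is 0, the least possible value. Otherwise both
  sequences are eventually finite and the cost even converges.\<close>

lemma coulomb_cpt_lower_semicontinuous:
  assumes "limitin cpt xs p sequentially" "limitin cpt ys q sequentially"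
  shows "coulomb_cpt p q \<le> liminf (\<lambda>n. coulomb_cpt (xs n) (ys n))"
proof (cases "p = None \<or> q = None")
  case True
  then show ?thesis by (auto simp: coulomb_cpt_eq)
next
  case False
  then obtain a b where ab: "p = Some a" "q = Some b" by auto
  note x = limitin_cpt_Some[OF assms(1)[unfolded ab]]
  note y = limitin_cpt_Some[OF assms(2)[unfolded ab]]
  have "(\<lambda>n. coulomb (the (xs n)) (the (ys n))) \<longlonglongrightarrow> coulomb a b"
    by (intro tendsto_coulomb x y)
  moreover have "\<forall>\<^sub>F n in sequentially. coulomb (the (xs n)) (the (ys n)) = coulomb_cpt (xs n) (ys n)"
    using x(1) y(1) by eventually_elim (auto simp: coulomb_cpt_eq)
  ultimately have "(\<lambda>n. coulomb_cpt (xs n) (ys n)) \<longlonglongrightarrow> coulomb a b"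
    by (rule Lim_transform_eventually)
  then show ?thesis
    by (simp add: ab lim_imp_Liminf)
qed

lemma sum_liminf_le_ennreal:
  fixes f :: "'b \<Rightarrow> nat \<Rightarrow> ennreal"
  assumes "finite A"
  shows "(\<Sum>i\<in>A. liminf (f i)) \<le> liminf (\<lambda>n. \<Sum>i\<in>A. f i n)"
  using nn_integral_liminf[of "\<lambda>n i. f i n" "count_space A"] assms
  by (simp add: nn_integral_count_space_finite)

lemma finite_pairs [simp]: "finite {(i, j). i < j \<and> j < (N::nat)}"
  by (rule finite_subset[of _ "{..<N} \<times> {..<N}"]) auto

lemma pair_sum_cong: "(\<And>i. i < N \<Longrightarrow> x i = y i) \<Longrightarrow> pair_sum N w x = pair_sum N w y"
  unfolding pair_sum_def by (rule sum.cong) auto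

lemma pair_sum_lower_semicontinuous:
  assumes "\<And>i. i < N \<Longrightarrow> limitin cpt (\<lambda>n. xs n i) (x i) sequentially"
  shows "pair_sum N coulomb_cpt x \<le> liminf (\<lambda>n. pair_sum N coulomb_cpt (xs n))"
proof -
  have "pair_sum N coulomb_cpt x \<le>
      (\<Sum>(i, j)\<in>{(i, j). i < j \<and> j < N}. liminf (\<lambda>n. coulomb_cpt (xs n i) (xs n j)))"
    unfolding pair_sum_def
    by (intro sum_mono) (auto intro!: coulomb_cpt_lower_semicontinuous assms)
  also have "\<dots> \<le> liminf (\<lambda>n. pair_sum N coulomb_cpt (xs n))"
    using sum_liminf_le_ennreal[OF finite_pairs, where f = "\<lambda>(i, j) n. coulomb_cpt (xs n i) (xs n j)"]
    by (simp add: pair_sum_def case_prod_unfold)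
  finally show ?thesis .
qed

lemma measurable_pair_sum_coulomb_cpt [measurable]:
  assumes [measurable]: "\<And>i. i < N \<Longrightarrow> (\<lambda>x. F x i) \<in> M \<rightarrow>\<^sub>M borel_alg (cpt :: 'a::euclidean_space option topology)"
  shows "(\<lambda>x. pair_sum N coulomb_cpt (F x)) \<in> borel_measurable M"
  unfolding pair_sum_def
proof (rule borel_measurable_sum, safe)
  fix i j assume ij: "i < j" "j < N"
  then have [measurable]: "(\<lambda>x. F x i) \<in> M \<rightarrow>\<^sub>M borel_alg (cpt :: 'a option topology)"
    "(\<lambda>x. F x j) \<in> M \<rightarrow>\<^sub>M borel_alg (cpt :: 'a option topology)"
    by auto
  have [measurable]: "Measurable.pred (borel_alg (cpt :: 'a option topology)) (\<lambda>p. p = None)"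
    by (subst measurable_cpt_iff) simp
  show "(\<lambda>x. coulomb_cpt (F x i) (F x j)) \<in> borel_measurable M"
    unfolding coulomb_cpt_eq coulomb_def by measurable
qed

lemma measurable_pair_sum_coulomb [measurable]:
  assumes [measurable]: "\<And>i. i < N \<Longrightarrow> (\<lambda>x. F x i) \<in> M \<rightarrow>\<^sub>M (borel :: 'a::euclidean_space measure)"
  shows "(\<lambda>x. pair_sum N coulomb (F x)) \<in> borel_measurable M"
  unfolding pair_sum_def
proof (rule borel_measurable_sum, safe)
  fix i j assume ij: "i < j" "j < N"
  then have [measurable]: "(\<lambda>x. F x i) \<in> borel_measurable M" "(\<lambda>x. F x j) \<in> borel_measurable M"
    by auto
  show "(\<lambda>x. coulomb (F x i) (F x j)) \<in> borel_measurable M"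
    unfolding coulomb_def by measurable
qed

text \<open>The density removes the mass at \<open>None\<close> first, so that the unspecified value
  \<open>the None\<close> receives none.\<close>

definition finite_part :: "'a::euclidean_space option measure \<Rightarrow> 'a measure" where
  "finite_part \<nu> = distr (density \<nu> (indicator (range Some))) borel the"

lemma sets_finite_part [simp]: "sets (finite_part \<nu>) = sets borel"
  and space_finite_part [simp]: "space (finite_part \<nu>) = UNIV"
  by (simp_all add: finite_part_def)

context
  fixes \<nu> :: "'a::euclidean_space option measure"
  assumes \<nu> [measurable_cong]: "sets \<nu> = sets (borel_alg cpt)"
begin

lemma range_Some_sets [measurable]: "range Some \<in> sets \<nu>"
  by (simp add: \<nu> image_Some_sets_cpt)

lemma emeasure_finite_part:
  assumes [measurable]: "B \<in> sets borel"
  shows "emeasure (finite_part \<nu>) B = emeasure \<nu> (Some ` B)"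
proof -
  have sp: "space \<nu> = UNIV"
    using sets_eq_imp_space_eq[OF \<nu>] by simp
  have m: "the -` B \<in> sets \<nu>"
    using measurable_sets[of the \<nu> borel B] by (simp add: sp)
  have "emeasure (finite_part \<nu>) B = (\<integral>\<^sup>+p. indicator (range Some) p * indicator (the -` B) p \<partial>\<nu>)"
    unfolding finite_part_def using m
    by (simp add: emeasure_distr sp emeasure_density)
  also have "\<dots> = (\<integral>\<^sup>+p. indicator (Some ` B) p \<partial>\<nu>)"
    by (intro nn_integral_cong) (auto simp: indicator_def)
  also have "\<dots> = emeasure \<nu> (Some ` B)"
    by (simp add: \<nu> image_Some_sets_cpt)
  finally show ?thesis .
qed

lemma integral_finite_part:
  fixes f :: "'a \<Rightarrow> real"
  assumes [measurable]: "f \<in> borel_measurable borel"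
  shows "(\<integral>x. f x \<partial>finite_part \<nu>) = (\<integral>p. cpt_ext f p \<partial>\<nu>)"
proof -
  have "(\<integral>x. f x \<partial>finite_part \<nu>) = (\<integral>p. f (the p) \<partial>density \<nu> (\<lambda>p. ennreal (indicator (range Some) p)))"
    unfolding finite_part_def by (simp add: integral_distr ennreal_indicator)
  also have "\<dots> = (\<integral>p. indicator (range Some) p *\<^sub>R f (the p) \<partial>\<nu>)"
    by (intro integral_density) auto
  also have "\<dots> = (\<integral>p. cpt_ext f p \<partial>\<nu>)"
    by (intro Bochner_Integration.integral_cong) (auto simp: cpt_ext_def split: option.splits)
  finally show ?thesis .
qed

end

text \<open>The indicator of a bounded open set is the limit of truncated multiples of the distance
  to its complement. These have bounded support, hence are admissible test functions, and the
  bounded boxes form an intersection-stable generator.\<close>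

lemma measure_eqI_vanishing_at_infinity:
  fixes M N :: "'a::euclidean_space measure"
  assumes "finite_measure M" "finite_measure N"
    and sets: "sets M = sets borel" "sets N = sets borel"
    and eq: "\<And>f :: 'a \<Rightarrow> real. continuous_on UNIV f \<Longrightarrow> (f \<longlongrightarrow> 0) at_infinity \<Longrightarrow>
      (\<integral>x. f x \<partial>M) = (\<integral>x. f x \<partial>N)"
  shows "M = N"
proof -
  interpret M: finite_measure M by fact
  interpret N: finite_measure N by fact
  have emeasure_eq: "emeasure M U = emeasure N U" if U: "open U" "bounded U" for U
  proof -
    define f where "f k x = min 1 (real k * infdist x (- U))" for k x
    \<comment> \<open>The distance \<open>infdist\<close> to the empty set is 0 by convention, so
      the approximation needs a nonempty complement.\<close>
    have "- U \<noteq> {}"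
      using U(2) not_bounded_UNIV double_complement[of U] by (metis Compl_empty_eq)
    have cont: "continuous_on UNIV (f k)" for k
      unfolding f_def by (intro continuous_intros)
    obtain R where R: "\<And>x. x \<in> U \<Longrightarrow> norm x \<le> R"
      using U(2) by (auto simp: bounded_iff)
    have "f k x = 0" if "R + 1 \<le> norm x" for k x
    proof -
      have "x \<in> - U" using that R[of x] by auto
      then show ?thesis by (simp add: f_def infdist_zero)
    qed
    then have "\<forall>\<^sub>F x in at_infinity. 0 = f k x" for k
      unfolding eventually_at_infinity by metis
    then have vanish: "(f k \<longlongrightarrow> 0) at_infinity" for k
      by (rule Lim_transform_eventually[OF tendsto_const])
    have lim: "(\<lambda>k. f k x) \<longlonglongrightarrow> indicator U x" for x
    proof (cases "x \<in> U")
      case True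
      then have "infdist x (- U) > 0"
        using U(1) \<open>- U \<noteq> {}\<close> by (intro infdist_pos_not_in_closed) auto
      then obtain k0 where "1 < real k0 * infdist x (- U)"
        using reals_Archimedean3 by blast
      moreover have "real k0 * infdist x (- U) \<le> real k * infdist x (- U)" if "k0 \<le> k" for k
        using that by (intro mult_right_mono) (auto simp: infdist_nonneg)
      ultimately have "1 = f k x" if "k0 \<le> k" for k
        using that by (fastforce simp: f_def)
      then have "\<forall>\<^sub>F k in sequentially. 1 = f k x"
        by (rule eventually_sequentiallyI)
      then show ?thesis
        using True by (auto intro: Lim_transform_eventually[OF tendsto_const])
    next
      case False
      then show ?thesis by (simp add: f_def)
    qed
    have conv: "(\<lambda>k. \<integral>x. f k x \<partial>K) \<longlonglongrightarrow> measure K U"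
      if "finite_measure K" "sets K = sets borel" for K
    proof -
      interpret K: finite_measure K by fact
      note [measurable_cong] = that(2)
      have [measurable]: "f k \<in> borel_measurable K" for k
        using borel_measurable_continuous_onI[OF cont[of k]] by (simp cong: measurable_cong_sets)
      have [measurable]: "U \<in> sets K" using U(1) that(2) by simp
      have "(\<lambda>k. \<integral>x. f k x \<partial>K) \<longlonglongrightarrow> (\<integral>x. indicator U x \<partial>K)"
        by (rule integral_dominated_convergence[where w="\<lambda>_. 1"])
           (auto simp: lim, auto simp: f_def infdist_nonneg)
      then show ?thesis by simp
    qed
    have "measure M U = measure N U"
      by (rule LIMSEQ_unique[OF conv[OF assms(1) sets(1)]])
         (use conv[OF assms(2) sets(2)] eq[OF cont vanish] in simp)
    then show ?thesis
      by (simp add: M.emeasure_eq_measure N.emeasure_eq_measure)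
  qed
  let ?E = "range (\<lambda>(a, b). box a b :: 'a set)"
  show ?thesis
  proof (rule measure_eqI_generator_eq)
    show "Int_stable ?E"
      by (auto simp: Int_stable_def box_Int_box)
    show "?E \<subseteq> Pow UNIV" "sets M = sigma_sets UNIV ?E" "sets N = sigma_sets UNIV ?E"
      by (simp_all add: sets borel_eq_box)
    let ?A = "\<lambda>n::nat. box (- (real n *\<^sub>R One)) (real n *\<^sub>R One) :: 'a set"
    show "range ?A \<subseteq> ?E" "(\<Union>i. ?A i) = UNIV"
      unfolding UN_box_eq_UNIV by auto
    show "emeasure M (?A i) \<noteq> \<infinity>" for i
      by simp
    show "emeasure M X = emeasure N X" if "X \<in> ?E" for X
      using that by (auto intro!: emeasure_eq open_box bounded_box)
  qed
qed

section \<open>Probabilities on X and their finite parts\<close>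

lemma sets_cpt_extend [simp]: "sets (cpt_extend \<rho>) = sets (borel_alg cpt)"
proof -
  have "sigma_algebra UNIV (sets (borel_alg (cpt :: 'a option topology)))"
    using sets.sigma_algebra_axioms[of "borel_alg (cpt :: 'a option topology)"] by simp
  then show ?thesis
    by (simp add: cpt_extend_def sigma_algebra.sigma_sets_eq)
qed

context
  fixes \<rho> :: "'a::euclidean_space measure"
  assumes \<rho>: "\<rho> \<in> borel_subprobs euclidean"
begin

lemma subprob_sets [measurable_cong]: "sets \<rho> = sets borel"
  and subprob_le_1: "emeasure \<rho> UNIV \<le> 1"
  using \<rho> by (simp_all add: borel_subprobs_def borel_alg_euclidean)

lemma subprob_finite: "finite_measure \<rho>"
proof
  have "space \<rho> = UNIV"
    using sets_eq_imp_space_eq[OF subprob_sets] by simp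
  then show "emeasure \<rho> (space \<rho>) \<noteq> \<infinity>"
    using subprob_le_1 by (auto simp: top_unique)
qed

lemma emeasure_cpt_extend':
  assumes "A \<in> sets (borel_alg cpt)"
  shows "emeasure (cpt_extend \<rho>) A =
    emeasure \<rho> (Some -` A) + (1 - emeasure \<rho> UNIV) * indicator A None"
proof -
  have "space \<rho> = UNIV"
    using sets_eq_imp_space_eq[OF subprob_sets] by simp
  moreover have "Some \<in> \<rho> \<rightarrow>\<^sub>M borel_alg (cpt :: 'a option topology)"
    using measurable_Some by (simp cong: measurable_cong_sets add: subprob_sets)
  ultimately show ?thesis
    using assms by (simp add: emeasure_cpt_extend emeasure_distr)
qed

lemma prob_space_cpt_extend: "prob_space (cpt_extend \<rho>)"
proof
  have "space (cpt_extend \<rho>) = UNIV"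
    using sets_eq_imp_space_eq[OF sets_cpt_extend, of \<rho>] by simp
  moreover have "UNIV \<in> sets (borel_alg (cpt :: 'a option topology))"
    using sets.top[of "borel_alg (cpt :: 'a option topology)"] by simp
  ultimately show "emeasure (cpt_extend \<rho>) (space (cpt_extend \<rho>)) = 1"
    using subprob_le_1 by (simp add: emeasure_cpt_extend' add_diff_inverse_ennreal)
qed

lemma finite_part_cpt_extend: "finite_part (cpt_extend \<rho>) = \<rho>"
proof (rule measure_eqI)
  fix B assume "B \<in> sets (finite_part (cpt_extend \<rho>))"
  then show "emeasure (finite_part (cpt_extend \<rho>)) B = emeasure \<rho> B"
    by (simp add: emeasure_finite_part emeasure_cpt_extend' image_Some_sets_cpt inj_vimage_image_eq)
qed (simp add: subprob_sets)

lemma integral_cpt_extend: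
  fixes f :: "'a \<Rightarrow> real"
  assumes "f \<in> borel_measurable borel"
  shows "(\<integral>p. cpt_ext f p \<partial>cpt_extend \<rho>) = (\<integral>x. f x \<partial>\<rho>)"
  using integral_finite_part[OF sets_cpt_extend assms, of \<rho>] by (simp add: finite_part_cpt_extend)

text \<open>The test functions determine the finite part; the mass of \<open>None\<close>, which
  they do not see, is what is missing to total mass 1.\<close>

lemma cpt_extend_unique:
  assumes "prob_space \<nu>" and \<nu>: "sets \<nu> = sets (borel_alg cpt)"
    and eq: "\<And>f. continuous_on UNIV f \<Longrightarrow> (f \<longlongrightarrow> 0) at_infinity \<Longrightarrow>
      (\<integral>p. cpt_ext f p \<partial>\<nu>) = (\<integral>x. f x \<partial>\<rho>)"
  shows "\<nu> = cpt_extend \<rho>"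
proof -
  interpret \<nu>: prob_space \<nu> by fact
  have sp: "space \<nu> = UNIV"
    using sets_eq_imp_space_eq[OF \<nu>] by simp
  have "finite_part \<nu> = \<rho>"
  proof (rule measure_eqI_vanishing_at_infinity)
    show "finite_measure (finite_part \<nu>)"
      by standard (simp add: emeasure_finite_part[OF \<nu>])
    show "(\<integral>x. f x \<partial>finite_part \<nu>) = (\<integral>x. f x \<partial>\<rho>)"
      if "continuous_on UNIV f" "(f \<longlongrightarrow> 0) at_infinity" for f :: "'a \<Rightarrow> real"
      using integral_finite_part[OF \<nu> borel_measurable_continuous_onI[OF that(1)]] eq[OF that]
      by simp
  qed (auto simp: subprob_sets subprob_finite)
  then have fin: "emeasure \<nu> (Some ` B) = emeasure \<rho> B" if "B \<in> sets borel" for B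
    using emeasure_finite_part[OF \<nu> that] by simp
  have "{None} = space \<nu> - range Some"
    using notin_range_Some by (auto simp: sp)
  then have None: "emeasure \<nu> {None} = 1 - emeasure \<rho> UNIV"
    using fin[of UNIV] emeasure_compl[OF range_Some_sets[OF \<nu>]] \<nu>.emeasure_finite[of "range Some"]
    by (simp add: \<nu>.emeasure_space_1)
  show ?thesis
  proof (rule measure_eqI)
    fix A assume A: "A \<in> sets \<nu>"
    have S: "Some -` A \<in> sets borel"
      using measurable_sets[OF measurable_Some, of A] A \<nu> by simp
    have *: "A = Some ` (Some -` A) \<union> (A \<inter> {None})"
      by auto
    have "emeasure \<nu> A = emeasure \<nu> (Some ` (Some -` A)) + emeasure \<nu> (A \<inter> {None})"
      by (subst *, rule plus_emeasure[symmetric])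
         (auto simp: \<nu> S image_Some_sets_cpt None_sets_cpt A[unfolded \<nu>])
    also have "\<dots> = emeasure (cpt_extend \<rho>) A"
      using A by (cases "None \<in> A") (auto simp: \<nu> fin[OF S, unfolded image_vimage_eq] None emeasure_cpt_extend')
    finally show "emeasure \<nu> A = emeasure (cpt_extend \<rho>) A" .
  qed (simp add: \<nu>)
qed

end

section \<open>Compactness of plans\<close>

lemma continuous_map_power_topI:
  assumes "\<And>i. i < N \<Longrightarrow> continuous_map X T (\<lambda>x. F x i)"
  shows "continuous_map X (power_top N T) (\<lambda>x. restrict (F x) {..<N})"
  unfolding power_top_def continuous_map_componentwise
  using assms by auto

lemma plansD:
  assumes "P \<in> plans N T \<mu>"
  shows "prob_space P" "sets P = sets (borel_alg (power_top N T))"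
    "\<And>i. i < N \<Longrightarrow> distr P (borel_alg T) (\<lambda>x. x i) = \<mu>"
  using assms by (auto simp: plans_def borel_probs_def)

lemma plan_component_measurable:
  assumes "P \<in> plans N T \<mu>" "i < N"
  shows "(\<lambda>x. x i) \<in> P \<rightarrow>\<^sub>M borel_alg T"
  using measurable_power_top_component[OF assms(2), of T] plansD(2)[OF assms(1)]
  by (simp cong: measurable_cong_sets)

lemma plansI:
  assumes "prob_space M"
    and F: "(\<lambda>x. restrict (F x) {..<N}) \<in> M \<rightarrow>\<^sub>M borel_alg (power_top N T)"
    and marginals: "\<And>i. i < N \<Longrightarrow> distr M (borel_alg T) (\<lambda>x. F x i) = \<mu>"
  shows "distr M (borel_alg (power_top N T)) (\<lambda>x. restrict (F x) {..<N}) \<in> plans N T \<mu>"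
    (is "?P \<in> _")
proof -
  interpret prob_space M by fact
  have "distr ?P (borel_alg T) (\<lambda>x. x i) = \<mu>" if "i < N" for i
    using that distr_distr[OF measurable_power_top_component[OF that] F] marginals[OF that]
    by (simp add: o_def)
  then show ?thesis
    using F by (simp add: plans_def borel_probs_def prob_space_distr)
qed

text \<open>The witness is the image of \<open>\<mu>\<close> under the diagonal map. Its cost may be
  infinite; it is there so that infima are taken over nonempty sets.\<close>

lemma plans_nonempty:
  assumes "\<mu> \<in> borel_probs T"
  shows "plans N T \<mu> \<noteq> {}"
proof -
  have \<mu>: "prob_space \<mu>" "sets \<mu> = sets (borel_alg T)"
    using assms by (auto simp: borel_probs_def)
  have "(\<lambda>x. restrict (\<lambda>i. x) {..<N}) \<in> \<mu> \<rightarrow>\<^sub>M borel_alg (power_top N T)"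
    using measurable_continuous_map[OF continuous_map_power_topI[of N T T "\<lambda>x i. x"]] \<mu>(2)
    by (simp cong: measurable_cong_sets)
  moreover have "distr \<mu> (borel_alg T) (\<lambda>x. x) = \<mu>"
    using \<mu>(2) by (intro distr_id2) simp
  ultimately have "distr \<mu> (borel_alg (power_top N T)) (\<lambda>x. restrict (\<lambda>i. x) {..<N}) \<in> plans N T \<mu>"
    using \<mu>(1) by (intro plansI) auto
  then show ?thesis by blast
qed

lemma measurable_plan_code:
  assumes "P \<in> plans N cpt \<mu>"
  shows "cpt_code N \<in> borel_measurable P"
  using measurable_cpt_code plansD(2)[OF assms] by (simp cong: measurable_cong_sets)

lemma measurable_pair_sum_plan:
  assumes "P \<in> plans N cpt \<mu>"
  shows "pair_sum N coulomb_cpt \<in> borel_measurable P"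
  using measurable_pair_sum_coulomb_cpt[of N "\<lambda>x. x", OF plan_component_measurable[OF assms]] by simp

lemma limitin_cpt_curve:
  assumes "y \<longlonglongrightarrow> t"
  shows "limitin cpt (\<lambda>n. cpt_curve i (y n)) (cpt_curve i t) sequentially"
  using continuous_map_limit[OF continuous_map_cpt_curve, of y t sequentially i] assms
  by (simp add: o_def)

lemma measurable_cpt_curve: "cpt_curve i \<in> borel \<rightarrow>\<^sub>M borel_alg (cpt :: 'a::euclidean_space option topology)"
  using measurable_continuous_map[OF continuous_map_cpt_curve[where 'a='a]]
  by (simp add: borel_alg_euclidean)

text \<open>Coding the plans as probability measures on \<open>[0, 1]\<close> lets Helly's and Skorohod's theorems
  play the role of Prokhorov's theorem on the compact space \<open>X\<^sup>N\<close>.\<close>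
lemma plans_cpt_compact:
  fixes \<rho> :: "'a::euclidean_space measure" and v :: "nat \<Rightarrow> ennreal"
  assumes \<rho>: "\<rho> \<in> borel_subprobs euclidean"
    and Q: "\<And>n. Q n \<in> plans N cpt (\<nu> n)"
    and conv: "\<And>f :: 'a \<Rightarrow> real. continuous_on UNIV f \<Longrightarrow> (f \<longlongrightarrow> 0) at_infinity \<Longrightarrow>
      (\<lambda>n. \<integral>p. cpt_ext f p \<partial>\<nu> n) \<longlonglongrightarrow> (\<integral>x. f x \<partial>\<rho>)"
    and cost: "\<And>n. (\<integral>\<^sup>+x. pair_sum N coulomb_cpt x \<partial>Q n) \<le> v n"
    and v: "v \<longlonglongrightarrow> L"
  shows "\<exists>P\<in>plans N cpt (cpt_extend \<rho>). (\<integral>\<^sup>+x. pair_sum N coulomb_cpt x \<partial>P) \<le> L"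
proof -
  define \<mu> where "\<mu> n = distr (Q n) borel (cpt_code N)" for n
  have code: "cpt_code N \<in> borel_measurable (Q n)" for n
    by (rule measurable_plan_code[OF Q])
  have real: "real_distribution (\<mu> n)" for n
    unfolding \<mu>_def by (rule prob_space.real_distribution_distr[OF plansD(1)[OF Q] code])
  \<comment> \<open>\<open>tight\<close> is phrased with intervals open on the left, so the left
    endpoint has to lie below the possible code 0.\<close>
  have "measure (\<mu> n) {-1<..1} = 1" for n
  proof -
    interpret Q: prob_space "Q n" by (rule plansD(1)[OF Q])
    have "cpt_code N -` {-1<..1} \<inter> space (Q n) = space (Q n)"
      using cpt_code_bounds[of N] by (force intro: less_le_trans[of "-1" 0])
    then show ?thesis
      using code by (simp add: \<mu>_def measure_distr Q.prob_space)
  qed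
  then have "\<exists>a b. a < b \<and> (\<forall>n. 1 - \<epsilon> < measure (\<mu> n) {a<..b})" if "0 < \<epsilon>" for \<epsilon> :: real
    using that by (intro exI[of _ "-1"] exI[of _ 1]) simp
  then have "tight \<mu>"
    unfolding tight_def using real by blast
  then obtain r M where r: "strict_mono r" and M: "real_distribution M"
    and weak: "weak_conv_m (\<mu> \<circ> id \<circ> r) M"
    using tight_imp_convergent_subsubsequence[OF _ strict_mono_id] by blast
  have "real_distribution ((\<mu> \<circ> id \<circ> r) n)" for n
    using real by simp
  from Skorohod[OF this M weak] obtain \<Omega> :: "real measure" and Y :: "nat \<Rightarrow> real \<Rightarrow> real" and Z
    where \<Omega>: "prob_space \<Omega>"
      and "\<forall>n. Y n \<in> borel_measurable \<Omega>" "\<forall>n. distr \<Omega> borel (Y n) = (\<mu> \<circ> id \<circ> r) n"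
      and "Z \<in> \<Omega> \<rightarrow>\<^sub>M lborel"
      and "\<forall>\<omega>\<in>space \<Omega>. (\<lambda>n. Y n \<omega>) \<longlonglongrightarrow> Z \<omega>"
    by blast
  then have Y: "\<And>n. Y n \<in> borel_measurable \<Omega>" "\<And>n. distr \<Omega> borel (Y n) = \<mu> (r n)"
    and Z: "Z \<in> borel_measurable \<Omega>"
    and YZ: "\<And>\<omega>. \<omega> \<in> space \<Omega> \<Longrightarrow> (\<lambda>n. Y n \<omega>) \<longlonglongrightarrow> Z \<omega>"
    by simp_all
  interpret \<Omega>: prob_space \<Omega> by fact
  let ?curve = "\<lambda>t. restrict (\<lambda>i. cpt_curve i t :: 'a option) {..<N}"
  let ?P = "distr \<Omega> (borel_alg (power_top N cpt)) (\<lambda>\<omega>. ?curve (Z \<omega>))"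
  have curve: "?curve \<in> borel \<rightarrow>\<^sub>M borel_alg (power_top N cpt)"
    using measurable_continuous_map[OF continuous_map_power_topI[OF continuous_map_cpt_curve]]
    by (simp add: borel_alg_euclidean)
  have curveY: "(\<lambda>\<omega>. cpt_curve i (Y n \<omega>) :: 'a option) \<in> \<Omega> \<rightarrow>\<^sub>M borel_alg cpt" for i n
    by (rule measurable_compose[OF Y(1) measurable_cpt_curve])
  have curveZ: "(\<lambda>\<omega>. cpt_curve i (Z \<omega>) :: 'a option) \<in> \<Omega> \<rightarrow>\<^sub>M borel_alg cpt" for i
    by (rule measurable_compose[OF Z measurable_cpt_curve])
  have lim: "limitin cpt (\<lambda>n. cpt_curve i (Y n \<omega>) :: 'a option) (cpt_curve i (Z \<omega>)) sequentially"
    if "\<omega> \<in> space \<Omega>" for i \<omega>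
    by (rule limitin_cpt_curve[OF YZ[OF that]])
  have "distr \<Omega> (borel_alg cpt) (\<lambda>\<omega>. cpt_curve i (Z \<omega>)) = cpt_extend \<rho>" (is "?\<kappa> = _") if i: "i < N" for i
  proof (rule cpt_extend_unique[OF \<rho>])
    show "prob_space ?\<kappa>"
      by (rule \<Omega>.prob_space_distr[OF curveZ])
    fix f :: "'a \<Rightarrow> real"
    assume f: "continuous_on UNIV f" "(f \<longlongrightarrow> 0) at_infinity"
    obtain B where B: "\<And>x. \<bar>f x\<bar> \<le> B"
      using vanishing_at_infinity_bounded[OF f] by blast
    have fm: "cpt_ext f \<in> borel_measurable (borel_alg cpt)"
      by (intro measurable_cpt_ext borel_measurable_continuous_onI f)
    have fc: "(\<lambda>t. cpt_ext f (cpt_curve i t)) \<in> borel_measurable borel"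
      by (rule measurable_compose[OF measurable_cpt_curve fm])
    \<comment> \<open>\<open>Y n\<close> has the law of a coded plan and the curve undoes the code
      in coordinate \<open>i\<close>, so the integral depends only on the marginal of that
      plan.\<close>
    have eq: "(\<integral>\<omega>. cpt_ext f (cpt_curve i (Y n \<omega>)) \<partial>\<Omega>) = (\<integral>p. cpt_ext f p \<partial>\<nu> (r n))" for n
    proof -
      have "(\<integral>\<omega>. cpt_ext f (cpt_curve i (Y n \<omega>)) \<partial>\<Omega>) = (\<integral>t. cpt_ext f (cpt_curve i t) \<partial>\<mu> (r n))"
        unfolding Y(2)[symmetric] by (rule integral_distr[symmetric, OF Y(1) fc])
      also have "\<dots> = (\<integral>x. cpt_ext f (x i) \<partial>Q (r n))"
        unfolding \<mu>_def by (simp add: integral_distr[OF code fc] cpt_curve_code[OF i])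
      also have "\<dots> = (\<integral>p. cpt_ext f p \<partial>distr (Q (r n)) (borel_alg cpt) (\<lambda>x. x i))"
        by (rule integral_distr[symmetric, OF plan_component_measurable[OF Q i] fm])
      finally show ?thesis
        unfolding plansD(3)[OF Q i] .
    qed
    have "(\<lambda>n. \<integral>\<omega>. cpt_ext f (cpt_curve i (Y n \<omega>)) \<partial>\<Omega>) \<longlonglongrightarrow> (\<integral>\<omega>. cpt_ext f (cpt_curve i (Z \<omega>)) \<partial>\<Omega>)"
    proof (rule integral_dominated_convergence[where w="\<lambda>_. \<bar>B\<bar>"])
      show "AE \<omega> in \<Omega>. (\<lambda>n. cpt_ext f (cpt_curve i (Y n \<omega>))) \<longlonglongrightarrow> cpt_ext f (cpt_curve i (Z \<omega>))"
        by (intro AE_I2 tendsto_cpt_ext f lim)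
      show "AE \<omega> in \<Omega>. norm (cpt_ext f (cpt_curve i (Y n \<omega>))) \<le> \<bar>B\<bar>" for n
        using order_trans[OF B abs_ge_self] by (intro AE_I2) (auto simp: cpt_ext_def split: option.split)
    qed (auto intro: measurable_compose[OF curveY fm] measurable_compose[OF curveZ fm])
    moreover have "(\<lambda>n. \<integral>p. cpt_ext f p \<partial>\<nu> (r n)) \<longlonglongrightarrow> (\<integral>x. f x \<partial>\<rho>)"
      using LIMSEQ_subseq_LIMSEQ[OF conv[OF f] r] by (simp add: o_def)
    ultimately show "(\<integral>p. cpt_ext f p \<partial>?\<kappa>) = (\<integral>x. f x \<partial>\<rho>)"
      unfolding eq integral_distr[OF curveZ fm] by (rule LIMSEQ_unique)
  qed simp
  then have P: "?P \<in> plans N cpt (cpt_extend \<rho>)"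
    by (intro plansI \<Omega> measurable_compose[OF Z curve])
  have "(\<integral>\<^sup>+x. pair_sum N coulomb_cpt x \<partial>?P) = (\<integral>\<^sup>+\<omega>. pair_sum N coulomb_cpt (?curve (Z \<omega>)) \<partial>\<Omega>)"
    using measurable_pair_sum_plan[OF P] measurable_compose[OF Z curve]
    by (intro nn_integral_distr) (auto cong: measurable_cong_sets)
  also have "\<dots> = (\<integral>\<^sup>+\<omega>. pair_sum N coulomb_cpt (\<lambda>i. cpt_curve i (Z \<omega>) :: 'a option) \<partial>\<Omega>)"
    by (intro nn_integral_cong pair_sum_cong) simp
  also have "\<dots> \<le> (\<integral>\<^sup>+\<omega>. liminf (\<lambda>n. pair_sum N coulomb_cpt (\<lambda>i. cpt_curve i (Y n \<omega>) :: 'a option)) \<partial>\<Omega>)"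
    by (intro nn_integral_mono pair_sum_lower_semicontinuous lim)
  also have "\<dots> \<le> liminf (\<lambda>n. \<integral>\<^sup>+\<omega>. pair_sum N coulomb_cpt (\<lambda>i. cpt_curve i (Y n \<omega>) :: 'a option) \<partial>\<Omega>)"
    by (intro nn_integral_liminf measurable_pair_sum_coulomb_cpt curveY)
  also have "(\<lambda>n. \<integral>\<^sup>+\<omega>. pair_sum N coulomb_cpt (\<lambda>i. cpt_curve i (Y n \<omega>) :: 'a option) \<partial>\<Omega>) =
      (\<lambda>n. \<integral>\<^sup>+x. pair_sum N coulomb_cpt x \<partial>Q (r n))"
  proof
    fix n
    have m: "(\<lambda>t. pair_sum N coulomb_cpt (\<lambda>i. cpt_curve i t :: 'a option)) \<in> borel_measurable borel"
      by (intro measurable_pair_sum_coulomb_cpt measurable_cpt_curve)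
    have "(\<integral>\<^sup>+\<omega>. pair_sum N coulomb_cpt (\<lambda>i. cpt_curve i (Y n \<omega>) :: 'a option) \<partial>\<Omega>) =
        (\<integral>\<^sup>+t. pair_sum N coulomb_cpt (\<lambda>i. cpt_curve i t :: 'a option) \<partial>\<mu> (r n))"
      unfolding Y(2)[symmetric] using m by (intro nn_integral_distr[symmetric] Y(1)) simp
    also have "\<dots> = (\<integral>\<^sup>+x. pair_sum N coulomb_cpt (\<lambda>i. cpt_curve i (cpt_code N x) :: 'a option) \<partial>Q (r n))"
      unfolding \<mu>_def using m by (intro nn_integral_distr code) simp
    also have "\<dots> = (\<integral>\<^sup>+x. pair_sum N coulomb_cpt x \<partial>Q (r n))"
      by (intro nn_integral_cong pair_sum_cong cpt_curve_code)
    finally show "(\<integral>\<^sup>+\<omega>. pair_sum N coulomb_cpt (\<lambda>i. cpt_curve i (Y n \<omega>) :: 'a option) \<partial>\<Omega>) =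
        (\<integral>\<^sup>+x. pair_sum N coulomb_cpt x \<partial>Q (r n))" .
  qed
  also have "liminf (\<lambda>n. \<integral>\<^sup>+x. pair_sum N coulomb_cpt x \<partial>Q (r n)) \<le> liminf (\<lambda>n. v (r n))"
    by (intro Liminf_mono always_eventually allI cost)
  also have "liminf (\<lambda>n. v (r n)) = L"
    using LIMSEQ_subseq_LIMSEQ[OF v r] by (intro lim_imp_Liminf) (simp_all add: o_def)
  finally show ?thesis
    using P by blast
qed

text \<open>The \<open>LEAST\<close> is informative only once a minimiser exists. A minimising
  sequence has constant marginals, for which the convergence assumed in
  \<open>plans_cpt_compact\<close> is an equality.\<close>

lemma C_tilde_attained:
  assumes \<rho>: "\<rho> \<in> borel_subprobs euclidean"
  obtains P where "P \<in> plans N cpt (cpt_extend \<rho>)"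
    "C_tilde N (cpt_extend \<rho>) = (\<integral>\<^sup>+x. pair_sum N coulomb_cpt x \<partial>P)"
    "\<And>Q. Q \<in> plans N cpt (cpt_extend \<rho>) \<Longrightarrow>
      C_tilde N (cpt_extend \<rho>) \<le> (\<integral>\<^sup>+x. pair_sum N coulomb_cpt x \<partial>Q)"
proof -
  let ?J = "\<lambda>P. \<integral>\<^sup>+x. pair_sum N coulomb_cpt x \<partial>P"
  let ?S = "?J ` plans N cpt (cpt_extend \<rho>)"
  have "cpt_extend \<rho> \<in> borel_probs cpt"
    by (simp add: borel_probs_def prob_space_cpt_extend[OF \<rho>])
  then have "?S \<noteq> {}"
    using plans_nonempty by blast
  from Inf_as_limit[OF this] obtain v where v: "\<And>n. v n \<in> ?S" "v \<longlonglongrightarrow> Inf ?S"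
    by blast
  have "\<exists>Q. Q \<in> plans N cpt (cpt_extend \<rho>) \<and> v n = ?J Q" for n
    using v(1)[of n] by (elim imageE) (intro exI conjI)
  then obtain Q where Q: "\<And>n. Q n \<in> plans N cpt (cpt_extend \<rho>)" "\<And>n. v n = ?J (Q n)"
    using choice[of "\<lambda>n Q. Q \<in> plans N cpt (cpt_extend \<rho>) \<and> v n = ?J Q"] by auto
  have "\<exists>P\<in>plans N cpt (cpt_extend \<rho>). ?J P \<le> Inf ?S"
    by (rule plans_cpt_compact[OF \<rho> Q(1) _ eq_refl[OF Q(2)[symmetric]] v(2)])
       (simp add: integral_cpt_extend[OF \<rho> borel_measurable_continuous_onI])
  then obtain P where P: "P \<in> plans N cpt (cpt_extend \<rho>)" "?J P \<le> Inf ?S"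
    by blast
  have le: "?J P \<le> ?J Q" if "Q \<in> plans N cpt (cpt_extend \<rho>)" for Q
    using P(2) that by (auto intro: order_trans INF_lower)
  have "C_tilde N (cpt_extend \<rho>) = ?J P"
    unfolding C_tilde_def by (rule Least_equality) (use P(1) le in auto)
  with P(1) le show ?thesis
    by (intro that) auto
qed

section \<open>The two inequalities\<close>

lemma C_tilde_le_C_bar:
  fixes \<rho> :: "'a::euclidean_space measure"
  assumes \<rho>: "\<rho> \<in> borel_subprobs euclidean"
  shows "C_tilde N (cpt_extend \<rho>) \<le> C_bar N \<rho>"
  unfolding C_bar_def
proof (rule INF_greatest, clarify)
  fix \<rho>s assume \<rho>s: "\<forall>n. \<rho>s n \<in> borel_probs euclidean" and weak: "weak_star_conv \<rho>s \<rho>"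
  let ?c = "\<lambda>n. C_cost N (\<rho>s n)"
  \<comment> \<open>The compactness lemma asks for convergent cost bounds, hence the subsequence
    that realises the liminf.\<close>
  obtain r where r: "strict_mono r" "(?c \<circ> r) \<longlonglongrightarrow> liminf ?c"
    using liminf_subseq_lim by blast
  \<comment> \<open>The slack pays for choosing only nearly optimal plans; \<open>Suc n\<close>
    keeps it strictly positive from n = 0 on.\<close>
  define v where "v n = ?c (r n) + ennreal (1 / Suc n)" for n
  have "(\<lambda>n. ennreal (1 / Suc n)) \<longlonglongrightarrow> ennreal 0"
    by (intro tendsto_ennrealI LIMSEQ_Suc lim_1_over_n)
  then have v: "v \<longlonglongrightarrow> liminf ?c"
    unfolding v_def using tendsto_add[OF r(2)] by (fastforce simp: o_def)
  have "\<exists>P. P \<in> plans N euclidean (\<rho>s (r n)) \<and> (\<integral>\<^sup>+x. pair_sum N coulomb x \<partial>P) \<le> v n" for n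
  proof (cases "?c (r n) = \<infinity>")
    \<comment> \<open>No strict approximation of an infinite infimum is possible, but then
      \<open>v n\<close> is infinite and any plan will do.\<close>
    case True
    moreover obtain P where "P \<in> plans N euclidean (\<rho>s (r n))"
      using plans_nonempty \<rho>s by blast
    ultimately show ?thesis by (auto simp: v_def)
  next
    case False
    have "\<exists>P\<in>plans N euclidean (\<rho>s (r n)). (\<integral>\<^sup>+x. pair_sum N coulomb x \<partial>P) < ?c (r n) + ennreal (1 / Suc n)"
      by (rule INF_approx_ennreal[OF _ _ False]) (simp_all add: C_cost_def)
    then show ?thesis by (auto simp: v_def intro: less_imp_le)
  qed
  then obtain P where P: "\<And>n. P n \<in> plans N euclidean (\<rho>s (r n))"
    and cost: "\<And>n. (\<integral>\<^sup>+x. pair_sum N coulomb x \<partial>P n) \<le> v n"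
    by metis
  define Q :: "nat \<Rightarrow> (nat \<Rightarrow> 'a option) measure" where
    "Q n = distr (P n) (borel_alg (power_top N cpt)) (\<lambda>x. restrict (\<lambda>i. Some (x i)) {..<N})" for n
  have comp: "(\<lambda>x. x i) \<in> borel_measurable (P n)" if "i < N" for i n
    using plan_component_measurable[OF P that] by (simp add: borel_alg_euclidean)
  have "continuous_map (power_top N euclidean) (cpt :: 'a option topology) (\<lambda>x. Some (x i))" if "i < N" for i
    unfolding power_top_def using that
    by (intro continuous_map_compose[of _ euclidean "\<lambda>x. x i" _ Some, unfolded o_def]
          continuous_map_product_projection[of i "{..<N}" "\<lambda>_. euclidean"] continuous_map_Some) simp
  then have "(\<lambda>x. restrict (\<lambda>i. Some (x i)) {..<N}) \<in>
      borel_alg (power_top N euclidean) \<rightarrow>\<^sub>M borel_alg (power_top N (cpt :: 'a option topology))"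
    by (intro measurable_continuous_map continuous_map_power_topI)
  then have F: "(\<lambda>x. restrict (\<lambda>i. Some (x i)) {..<N}) \<in>
      P n \<rightarrow>\<^sub>M borel_alg (power_top N (cpt :: 'a option topology))" for n
    using plansD(2)[OF P] by (simp cong: measurable_cong_sets)
  have Q: "Q n \<in> plans N cpt (distr (\<rho>s (r n)) (borel_alg cpt) Some)" for n
    unfolding Q_def
  proof (rule plansI[OF plansD(1)[OF P] F])
    fix i assume i: "i < N"
    show "distr (P n) (borel_alg cpt) (\<lambda>x. Some (x i)) = distr (\<rho>s (r n)) (borel_alg cpt) Some"
      using distr_distr[OF measurable_Some comp[OF i], of n] plansD(3)[OF P i, of n]
      by (simp add: o_def borel_alg_euclidean)
  qed
  have Q_cost: "(\<integral>\<^sup>+x. pair_sum N coulomb_cpt x \<partial>Q n) \<le> v n" for n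
  proof -
    have "(\<integral>\<^sup>+x. pair_sum N coulomb_cpt x \<partial>Q n) =
        (\<integral>\<^sup>+x. pair_sum N coulomb_cpt (restrict (\<lambda>i. Some (x i)) {..<N}) \<partial>P n)"
      unfolding Q_def
      by (intro nn_integral_distr F measurable_pair_sum_coulomb_cpt)
         (simp add: measurable_power_top_component)
    also have "\<dots> = (\<integral>\<^sup>+x. pair_sum N coulomb x \<partial>P n)"
      by (intro nn_integral_cong) (auto simp: pair_sum_def intro!: sum.cong)
    finally show ?thesis using cost by simp
  qed
  have "\<exists>P\<in>plans N cpt (cpt_extend \<rho>). (\<integral>\<^sup>+x. pair_sum N coulomb_cpt x \<partial>P) \<le> liminf ?c"
  proof (rule plans_cpt_compact[OF \<rho> Q _ Q_cost v])
    fix f :: "'a \<Rightarrow> real" assume f: "continuous_on UNIV f" "(f \<longlongrightarrow> 0) at_infinity"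
    have "(\<integral>p. cpt_ext f p \<partial>distr (\<rho>s n) (borel_alg cpt) Some) = (\<integral>x. f x \<partial>\<rho>s n)" for n
    proof -
      have "Some \<in> \<rho>s n \<rightarrow>\<^sub>M borel_alg (cpt :: 'a option topology)"
        using \<rho>s measurable_Some
        by (auto simp: borel_probs_def borel_alg_euclidean cong: measurable_cong_sets)
      then show ?thesis
        using f(1) by (subst integral_distr) (auto intro: measurable_cpt_ext borel_measurable_continuous_onI)
    qed
    then show "(\<lambda>n. \<integral>p. cpt_ext f p \<partial>distr (\<rho>s (r n)) (borel_alg cpt) Some) \<longlonglongrightarrow> (\<integral>x. f x \<partial>\<rho>)"
      using weak f LIMSEQ_subseq_LIMSEQ[OF _ r(1)] by (auto simp: weak_star_conv_def o_def)
  qed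
  moreover obtain P where "\<And>Q. Q \<in> plans N cpt (cpt_extend \<rho>) \<Longrightarrow>
      C_tilde N (cpt_extend \<rho>) \<le> (\<integral>\<^sup>+x. pair_sum N coulomb_cpt x \<partial>Q)"
    using C_tilde_attained[OF \<rho>, of N] by blast
  ultimately show "C_tilde N (cpt_extend \<rho>) \<le> liminf ?c"
    by (meson order_trans)
qed

section \<open>Upper bound for the relaxed cost, by moving escaping mass to far points\<close>

definition far_point :: "real \<Rightarrow> nat \<Rightarrow> 'a::euclidean_space" where
  "far_point R l = ((2 + real l) * R) *\<^sub>R (SOME b. b \<in> Basis)"

text \<open>Finite points beyond radius \<open>R\<close> are moved as well, since they could lie
  close to a far point. The far points start at norm \<open>2 * R\<close>, which leaves a gap of
  \<open>R\<close> to the points that stay.\<close>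

definition spread :: "real \<Rightarrow> nat \<Rightarrow> 'a::euclidean_space option \<Rightarrow> 'a" where
  "spread R l p =
     (case p of None \<Rightarrow> far_point R l | Some x \<Rightarrow> if norm x \<le> R then x else far_point R l)"

lemma norm_some_Basis [simp]: "norm (SOME b. b \<in> Basis :: 'a::euclidean_space) = 1"
  using some_in_eq[of "Basis :: 'a set"] by simp

lemma norm_far_point: "0 \<le> R \<Longrightarrow> norm (far_point R l) = (2 + real l) * R"
  by (simp add: far_point_def)

lemma norm_far_point_diff:
  assumes "0 \<le> R" "l \<noteq> m"
  shows "R \<le> norm (far_point R l - far_point R m :: 'a::euclidean_space)"
proof -
  have "1 \<le> \<bar>real l - real m\<bar>"
    using assms(2) by linarith
  then have "R \<le> \<bar>real l - real m\<bar> * R"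
    using assms(1) mult_right_mono[of 1 _ R] by simp
  also have "\<dots> = norm (((real l - real m) * R) *\<^sub>R (SOME b. b \<in> Basis) :: 'a)"
    using assms(1) by (simp add: abs_mult)
  also have "((real l - real m) * R) *\<^sub>R (SOME b. b \<in> Basis) = (far_point R l - far_point R m :: 'a)"
    unfolding far_point_def scaleR_diff_left[symmetric] by (simp add: algebra_simps)
  finally show ?thesis .
qed

lemma coulomb_le_inverse:
  assumes "0 < R" "R \<le> norm (a - b)"
  shows "coulomb a b \<le> ennreal (1 / R)"
proof -
  have "coulomb a b = ennreal (1 / norm (a - b))"
    unfolding coulomb_def ennreal_1[symmetric] using assms by (intro divide_ennreal) auto
  also have "\<dots> \<le> ennreal (1 / R)"
    using assms by (intro ennreal_leI frac_le) auto
  finally show ?thesis .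
qed

text \<open>If both points stay, the cost is unchanged. Once one of them is moved, the distinct
  labels and the gap around the ball force a distance of at least \<open>R\<close>, whatever the
  original cost was.\<close>

lemma coulomb_spread_le:
  assumes R: "0 < R" and lm: "l \<noteq> m"
  shows "coulomb (spread R l p) (spread R m q) \<le> coulomb_cpt p q + ennreal (1 / R)"
proof -
  have near_far: "R \<le> norm (x - far_point R k)" if "norm x \<le> R" for x :: 'a and k
  proof -
    have "2 * R \<le> norm (far_point R k :: 'a)"
      using R by (simp add: norm_far_point)
    then show ?thesis
      using norm_triangle_ineq2[of "far_point R k" x] that by (simp add: norm_minus_commute)
  qed
  have far: "coulomb (spread R l p) (spread R m q) \<le> ennreal (1 / R)"
    if "R \<le> norm (spread R l p - spread R m q)"
    by (rule coulomb_le_inverse[OF R that])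
  show ?thesis
  proof (cases "\<exists>x y. p = Some x \<and> q = Some y \<and> norm x \<le> R \<and> norm y \<le> R")
    case True
    then show ?thesis by (auto simp: spread_def)
  next
    case False
    then have "R \<le> norm (spread R l p - spread R m q)"
      using norm_far_point_diff[of R l m] near_far R lm
      by (auto simp: spread_def norm_minus_commute split: option.splits)
    from far[OF this] show ?thesis
      by (rule order_trans) simp
  qed
qed

lemma add_mod_cancel_nat:
  fixes a b c N :: nat
  assumes "a < N" "b < N" "(c + a) mod N = (c + b) mod N"
  shows "a = b"
proof -
  have *: "a' = b'" if "a' \<le> b'" "b' < N" "(c + a') mod N = (c + b') mod N" for a' b'
  proof -
    have "N dvd (c + b') - (c + a')"
      using that mod_eq_dvd_iff_nat[of "c + a'" "c + b'" N] by simp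
    then show ?thesis
      using that by (auto dest: dvd_imp_le)
  qed
  show ?thesis
    using *[of a b] *[of b a] assms by (cases "a \<le> b") auto
qed

lemma map_pmf_rotate_uniform:
  fixes N :: nat
  assumes "0 < N"
  shows "map_pmf (\<lambda>k. (i + k) mod N) (pmf_of_set {..<N}) = pmf_of_set {..<N}"
proof (rule map_pmf_of_set_bij_betw)
  have "inj_on (\<lambda>k. (i + k) mod N) {..<N}"
    by (auto intro!: inj_onI dest: add_mod_cancel_nat)
  then show "bij_betw (\<lambda>k. (i + k) mod N) {..<N} {..<N}"
    using assms by (intro bij_betw_imageI endo_inj_surj) auto
qed (use assms in auto)

text \<open>On the full function space, coordinatewise measurability implies Borel measurability for
  the product topology. Padding with 0 moves to that space, and restriction to \<open>{..<N}\<close>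
  is a continuous way back.\<close>

lemma measurable_power_top_euclideanI:
  fixes F :: "'b \<Rightarrow> nat \<Rightarrow> 'a::euclidean_space"
  assumes "\<And>i. i < N \<Longrightarrow> (\<lambda>x. F x i) \<in> borel_measurable M"
  shows "(\<lambda>x. restrict (F x) {..<N}) \<in> M \<rightarrow>\<^sub>M borel_alg (power_top N euclidean)"
proof -
  let ?G = "\<lambda>x i. if i < N then F x i else 0"
  have G: "?G \<in> borel_measurable M"
  proof (rule measurable_coordinatewise_then_product)
    show "(\<lambda>x. ?G x i) \<in> borel_measurable M" for i
      using assms[of i] by (cases "i < N") simp_all
  qed
  have "continuous_map euclidean (power_top N euclidean) (\<lambda>x :: nat \<Rightarrow> 'a. restrict x {..<N})"
    by (rule continuous_map_power_topI) simp
  from measurable_continuous_map[OF this]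
  have "(\<lambda>x :: nat \<Rightarrow> 'a. restrict x {..<N}) \<in> borel \<rightarrow>\<^sub>M borel_alg (power_top N euclidean)"
    by (simp add: borel_alg_euclidean)
  from measurable_compose[OF G this]
  have "(\<lambda>x. restrict (?G x) {..<N}) \<in> M \<rightarrow>\<^sub>M borel_alg (power_top N euclidean)" .
  moreover have "restrict (?G x) {..<N} = restrict (F x) {..<N}" for x
    by auto
  ultimately show ?thesis by simp
qed

section \<open>Law of a spread point and cost of the spread plan\<close>

lemma measurable_spread:
  "(\<lambda>(p, l). spread R l p) \<in>
    borel_measurable (borel_alg (cpt :: 'a::euclidean_space option topology) \<Otimes>\<^sub>M count_space UNIV)"
proof -
  have "(\<lambda>z. spread R (fst z) (snd z)) \<in>
      borel_measurable (count_space UNIV \<Otimes>\<^sub>M borel_alg (cpt :: 'a option topology))"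
    by (rule measurable_pair_measure_countable1) (simp_all add: measurable_cpt_iff spread_def)
  from measurable_compose[OF measurable_pair_swap' this] show ?thesis
    by (simp add: case_prod_unfold)
qed

lemma measurable_spread_pmf:
  assumes "sets \<nu> = sets (borel_alg cpt)"
  shows "(\<lambda>(p, l). spread R l p) \<in> borel_measurable (\<nu> \<Otimes>\<^sub>M measure_pmf U)"
proof -
  have "sets (\<nu> \<Otimes>\<^sub>M measure_pmf U) = sets (borel_alg cpt \<Otimes>\<^sub>M count_space UNIV)"
    by (intro sets_pair_measure_cong assms) simp
  then show ?thesis
    using measurable_spread by (simp cong: measurable_cong_sets)
qed

text \<open>The law to be shared by all coordinates in \<open>C_cost_spread_law_le\<close>: there
  coordinate \<open>i\<close> carries the label \<open>(i + k) mod N\<close> with \<open>k\<close>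
  uniform, so its label is again uniform and independent of its position.\<close>

definition spread_law :: "nat \<Rightarrow> real \<Rightarrow> 'a::euclidean_space option measure \<Rightarrow> 'a measure" where
  "spread_law N R \<nu> = distr (\<nu> \<Otimes>\<^sub>M measure_pmf (pmf_of_set {..<N})) borel (\<lambda>(p, l). spread R l p)"

lemma prob_space_pair_pmf:
  assumes "prob_space \<nu>"
  shows "prob_space (\<nu> \<Otimes>\<^sub>M measure_pmf U)"
proof -
  interpret \<nu>: prob_space \<nu> by fact
  interpret pair_prob_space \<nu> "measure_pmf U" ..
  show ?thesis by (rule P.prob_space_axioms)
qed

lemma spread_law_in_borel_probs:
  assumes "prob_space \<nu>" "sets \<nu> = sets (borel_alg cpt)"
  shows "spread_law N R \<nu> \<in> borel_probs euclidean"
  unfolding spread_law_def borel_probs_def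
  using prob_space.prob_space_distr[OF prob_space_pair_pmf[OF assms(1)] measurable_spread_pmf[OF assms(2)]]
  by (simp add: borel_alg_euclidean)

text \<open>A common random cyclic shift of the far points keeps the far coordinates apart from each other
  and gives every coordinate the same law.\<close>
lemma C_cost_spread_law_le:
  fixes P :: "(nat \<Rightarrow> 'a::euclidean_space option) measure"
  assumes P: "P \<in> plans N cpt \<nu>" and N: "0 < N" and R: "0 < R"
  shows "C_cost N (spread_law N R \<nu>) \<le>
    (\<integral>\<^sup>+x. pair_sum N coulomb_cpt x \<partial>P) + of_nat (card {(i, j). i < j \<and> j < N}) * ennreal (1 / R)"
proof -
  let ?U = "measure_pmf (pmf_of_set {..<N})"
  define F :: "(nat \<Rightarrow> 'a option) \<times> nat \<Rightarrow> nat \<Rightarrow> 'a"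
    where "F z i = spread R ((i + snd z) mod N) (fst z i)" for z i
  interpret P: prob_space P by (rule plansD(1)[OF P])
  have \<nu>: "prob_space \<nu>" "sets \<nu> = sets (borel_alg cpt)"
    using P.prob_space_distr[OF plan_component_measurable[OF P N]] plansD(3)[OF P N] by auto
  have shift: "(\<lambda>(x, k). (x i, (i + k) mod N)) \<in> P \<Otimes>\<^sub>M ?U \<rightarrow>\<^sub>M borel_alg cpt \<Otimes>\<^sub>M count_space UNIV"
    if "i < N" for i
  proof -
    have 1: "(\<lambda>z. fst z i) \<in> P \<Otimes>\<^sub>M ?U \<rightarrow>\<^sub>M borel_alg cpt"
      by (rule measurable_compose[OF measurable_fst plan_component_measurable[OF P that]])
    have 2: "(\<lambda>z. (i + snd z) mod N) \<in> P \<Otimes>\<^sub>M ?U \<rightarrow>\<^sub>M count_space UNIV"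
      by (rule measurable_compose[OF measurable_snd]) simp
    show ?thesis
      using measurable_Pair[OF 1 2] by (simp add: case_prod_unfold)
  qed
  have F: "(\<lambda>z. F z i) \<in> borel_measurable (P \<Otimes>\<^sub>M ?U)" if "i < N" for i
    using measurable_compose[OF shift[OF that] measurable_spread] by (simp add: F_def case_prod_unfold)
  have marginal: "distr (P \<Otimes>\<^sub>M ?U) borel (\<lambda>z. F z i) = spread_law N R \<nu>" if "i < N" for i
  proof -
    have rot: "distr ?U (count_space UNIV) (\<lambda>k. (i + k) mod N) = ?U"
      using map_pmf_rotate_uniform[OF N, of i] by (simp flip: map_pmf_rep_eq)
    \<comment> \<open>Position and shift are independent, and the two components are transformed
      separately, so the image is again a product measure.\<close>
    have "distr (P \<Otimes>\<^sub>M ?U) (borel_alg cpt \<Otimes>\<^sub>M count_space UNIV) (\<lambda>(x, k). (x i, (i + k) mod N)) =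
        distr P (borel_alg cpt) (\<lambda>x. x i) \<Otimes>\<^sub>M distr ?U (count_space UNIV) (\<lambda>k. (i + k) mod N)"
      by (rule pair_measure_distr[symmetric, OF plan_component_measurable[OF P that]])
         (simp_all add: rot prob_space_imp_sigma_finite measure_pmf.prob_space_axioms)
    also have "\<dots> = \<nu> \<Otimes>\<^sub>M ?U"
      by (simp add: rot plansD(3)[OF P that])
    finally show ?thesis
      using distr_distr[OF measurable_spread shift[OF that]]
      by (simp add: spread_law_def F_def o_def case_prod_unfold)
  qed
  let ?P = "distr (P \<Otimes>\<^sub>M ?U) (borel_alg (power_top N euclidean)) (\<lambda>z. restrict (F z) {..<N})"
  let ?K = "of_nat (card {(i, j). i < j \<and> j < N}) :: ennreal"
  have "?P \<in> plans N euclidean (spread_law N R \<nu>)"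
    by (intro plansI prob_space_pair_pmf P.prob_space_axioms measurable_power_top_euclideanI F)
       (simp_all add: borel_alg_euclidean marginal)
  then have "C_cost N (spread_law N R \<nu>) \<le> (\<integral>\<^sup>+x. pair_sum N coulomb x \<partial>?P)"
    unfolding C_cost_def by (rule INF_lower)
  also have "\<dots> = (\<integral>\<^sup>+z. pair_sum N coulomb (restrict (F z) {..<N}) \<partial>(P \<Otimes>\<^sub>M ?U))"
  proof (intro nn_integral_distr measurable_power_top_euclideanI F measurable_pair_sum_coulomb)
    show "(\<lambda>x. x i) \<in> borel_measurable
        (distr (P \<Otimes>\<^sub>M ?U) (borel_alg (power_top N euclidean)) (\<lambda>z. restrict (F z) {..<N}))"
      if "i < N" for i
      using measurable_power_top_component[OF that, of "euclidean :: 'a topology"]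
      by (simp add: borel_alg_euclidean)
  qed
  also have "\<dots> \<le> (\<integral>\<^sup>+z. pair_sum N coulomb_cpt (fst z) + ?K * ennreal (1 / R) \<partial>(P \<Otimes>\<^sub>M ?U))"
  proof (rule nn_integral_mono)
    fix z
    have "pair_sum N coulomb (restrict (F z) {..<N}) \<le>
        (\<Sum>(i, j)\<in>{(i, j). i < j \<and> j < N}. coulomb_cpt (fst z i) (fst z j) + ennreal (1 / R))"
      unfolding pair_sum_def
    proof (rule sum_mono, clarify)
      fix i j assume ij: "i < j" "j < N"
      then have "(i + snd z) mod N \<noteq> (j + snd z) mod N"
        using add_mod_cancel_nat[of i N j "snd z"] by (auto simp: add.commute)
      then show "coulomb (restrict (F z) {..<N} i) (restrict (F z) {..<N} j) \<le>
          coulomb_cpt (fst z i) (fst z j) + ennreal (1 / R)"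
        using ij coulomb_spread_le[OF R] by (simp add: F_def)
    qed
    also have "\<dots> = pair_sum N coulomb_cpt (fst z) + ?K * ennreal (1 / R)"
      by (simp add: pair_sum_def case_prod_unfold sum.distrib)
    finally show "pair_sum N coulomb (restrict (F z) {..<N}) \<le>
        pair_sum N coulomb_cpt (fst z) + ?K * ennreal (1 / R)" .
  qed
  \<comment> \<open>The bound no longer involves the shift, so projecting to the first factor
    integrates it out.\<close>
  also have "\<dots> = (\<integral>\<^sup>+x. pair_sum N coulomb_cpt x + ?K * ennreal (1 / R) \<partial>distr (P \<Otimes>\<^sub>M ?U) P fst)"
    using measurable_pair_sum_plan[OF P] by (intro nn_integral_distr[symmetric]) auto
  also have "distr (P \<Otimes>\<^sub>M ?U) P fst = P"
    by (rule measure_pmf.distr_pair_fst)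
  also have "(\<integral>\<^sup>+x. pair_sum N coulomb_cpt x + ?K * ennreal (1 / R) \<partial>P) =
      (\<integral>\<^sup>+x. pair_sum N coulomb_cpt x \<partial>P) + ?K * ennreal (1 / R)"
    using measurable_pair_sum_plan[OF P] by (simp add: nn_integral_add P.emeasure_space_1)
  finally show ?thesis .
qed

text \<open>For a fixed label, a finite point is eventually left in place, while \<omega> is sent to
  points escaping to infinity, where \<open>f\<close> tends to 0. Hence the integrands converge
  pointwise to the extension of \<open>f\<close> by 0, under a uniform bound.\<close>

lemma weak_star_conv_spread_law:
  fixes \<rho> :: "'a::euclidean_space measure"
  assumes \<rho>: "\<rho> \<in> borel_subprobs euclidean"
  shows "weak_star_conv (\<lambda>n. spread_law N (Suc n) (cpt_extend \<rho>)) \<rho>"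
  unfolding weak_star_conv_def
proof (intro allI impI, elim conjE)
  fix f :: "'a \<Rightarrow> real" assume f: "continuous_on UNIV f" "(f \<longlongrightarrow> 0) at_infinity"
  let ?\<nu> = "cpt_extend \<rho>" and ?U = "measure_pmf (pmf_of_set {..<N})"
  have fm: "f \<in> borel_measurable borel"
    by (rule borel_measurable_continuous_onI[OF f(1)])
  have sm: "(\<lambda>(p, l). spread R l p) \<in> borel_measurable (?\<nu> \<Otimes>\<^sub>M ?U)" for R
    by (rule measurable_spread_pmf) simp
  have em: "cpt_ext f \<in> borel_measurable ?\<nu>"
    using measurable_cpt_ext[OF fm] by (simp cong: measurable_cong_sets)
  obtain B where B: "\<And>x. \<bar>f x\<bar> \<le> B"
    using vanishing_at_infinity_bounded[OF f] by blast
  interpret prob_space "?\<nu> \<Otimes>\<^sub>M ?U"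
    by (rule prob_space_pair_pmf[OF prob_space_cpt_extend[OF \<rho>]])
  have lim: "(\<lambda>n. f (spread (Suc n) l p)) \<longlonglongrightarrow> cpt_ext f p" for l p
  proof (cases p)
    case None
    have "filterlim (\<lambda>n. norm (far_point (Suc n) l :: 'a)) at_top sequentially"
    proof (rule filterlim_at_top_mono)
      show "filterlim (\<lambda>n. real n) at_top sequentially"
        by (rule filterlim_real_sequentially)
      show "\<forall>\<^sub>F n in sequentially. real n \<le> norm (far_point (Suc n) l :: 'a)"
        by (intro always_eventually allI) (simp add: norm_far_point algebra_simps)
    qed
    then have "filterlim (\<lambda>n. far_point (Suc n) l :: 'a) at_infinity sequentially"
      by (rule filterlim_norm_at_top_imp_at_infinity)
    from filterlim_compose[OF f(2) this] show ?thesis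
      by (simp add: None spread_def)
  next
    case (Some x)
    obtain n0 where "norm x \<le> real n0"
      using real_arch_simple by blast
    then have "\<forall>\<^sub>F n in sequentially. f x = f (spread (Suc n) l p)"
      by (intro eventually_sequentiallyI[of n0]) (simp add: Some spread_def)
    then show ?thesis
      by (simp add: Some Lim_transform_eventually[OF tendsto_const])
  qed
  have "(\<lambda>n. \<integral>z. f (spread (Suc n) (snd z) (fst z)) \<partial>(?\<nu> \<Otimes>\<^sub>M ?U)) \<longlonglongrightarrow>
      (\<integral>z. cpt_ext f (fst z) \<partial>(?\<nu> \<Otimes>\<^sub>M ?U))"
  proof (rule integral_dominated_convergence[where w="\<lambda>_. B"])
    show "(\<lambda>z. f (spread (Suc n) (snd z) (fst z))) \<in> borel_measurable (?\<nu> \<Otimes>\<^sub>M ?U)" for n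
      using measurable_compose[OF sm fm] by (simp add: case_prod_unfold)
    show "(\<lambda>z. cpt_ext f (fst z)) \<in> borel_measurable (?\<nu> \<Otimes>\<^sub>M ?U)"
      by (rule measurable_compose[OF measurable_fst em])
  qed (use B lim in auto)
  moreover have "(\<integral>z. cpt_ext f (fst z) \<partial>(?\<nu> \<Otimes>\<^sub>M ?U)) = (\<integral>x. f x \<partial>\<rho>)"
  proof -
    have "(\<integral>z. cpt_ext f (fst z) \<partial>(?\<nu> \<Otimes>\<^sub>M ?U)) = (\<integral>p. cpt_ext f p \<partial>distr (?\<nu> \<Otimes>\<^sub>M ?U) ?\<nu> fst)"
      by (rule integral_distr[symmetric, OF measurable_fst em])
    then show ?thesis
      by (simp add: measure_pmf.distr_pair_fst integral_cpt_extend[OF \<rho> fm])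
  qed
  moreover have "(\<integral>x. f x \<partial>spread_law N R ?\<nu>) = (\<integral>z. f (spread R (snd z) (fst z)) \<partial>(?\<nu> \<Otimes>\<^sub>M ?U))" for R
    unfolding spread_law_def integral_distr[OF sm fm] by (simp add: case_prod_unfold)
  ultimately show "(\<lambda>n. \<integral>x. f x \<partial>spread_law N (Suc n) ?\<nu>) \<longlonglongrightarrow> (\<integral>x. f x \<partial>\<rho>)"
    by simp
qed

lemma C_bar_le_C_tilde:
  assumes \<rho>: "\<rho> \<in> borel_subprobs euclidean" and N: "0 < N"
  shows "C_bar N \<rho> \<le> C_tilde N (cpt_extend \<rho>)"
proof -
  \<comment> \<open>The radius \<open>Suc n\<close> is positive from the start, and the added cost,
    the number of pairs divided by it, tends to 0.\<close>
  let ?\<rho>s = "\<lambda>n. spread_law N (Suc n) (cpt_extend \<rho>)"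
  let ?K = "of_nat (card {(i, j). i < j \<and> j < N}) :: ennreal"
  let ?C = "C_tilde N (cpt_extend \<rho>)"
  obtain P where P: "P \<in> plans N cpt (cpt_extend \<rho>)"
    and opt: "?C = (\<integral>\<^sup>+x. pair_sum N coulomb_cpt x \<partial>P)"
    using C_tilde_attained[OF \<rho>, of N] by blast
  have "?\<rho>s n \<in> borel_probs euclidean" for n
    by (rule spread_law_in_borel_probs[OF prob_space_cpt_extend[OF \<rho>] sets_cpt_extend])
  then have "C_bar N \<rho> \<le> liminf (\<lambda>n. C_cost N (?\<rho>s n))"
    unfolding C_bar_def using weak_star_conv_spread_law[OF \<rho>] by (intro INF_lower) blast
  also have "\<dots> \<le> liminf (\<lambda>n. ?C + ?K * ennreal (1 / Suc n))"
    unfolding opt using C_cost_spread_law_le[OF P N] by (intro Liminf_mono always_eventually allI) simp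
  also have "\<dots> = ?C"
  proof (rule lim_imp_Liminf)
    have "(\<lambda>n. ennreal (1 / Suc n)) \<longlonglongrightarrow> ennreal 0"
      by (intro tendsto_ennrealI LIMSEQ_Suc lim_1_over_n)
    then have "(\<lambda>n. ?C + ?K * ennreal (1 / Suc n)) \<longlonglongrightarrow> ?C + ?K * ennreal 0"
      by (intro tendsto_add tendsto_const ennreal_tendsto_cmult) (auto simp: less_top[symmetric])
    then show "(\<lambda>n. ?C + ?K * ennreal (1 / Suc n)) \<longlonglongrightarrow> ?C"
      by simp
  qed simp
  finally show ?thesis .
qed

theorem proposition2p1:
  fixes \<rho> :: "(real ^ 'd) measure" and N :: nat
  assumes "N \<ge> 2"
    and "\<rho> \<in> borel_subprobs euclidean"
  shows "C_bar N \<rho> = C_tilde N (cpt_extend \<rho>)"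
  using C_bar_le_C_tilde[OF assms(2), of N] C_tilde_le_C_bar[OF assms(2), of N] assms(1)
  by (intro antisym) auto

end
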